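(* If $K$ is a knot such that $\operatorname{MRI}(K)<\operatorname{Reg}(K)$, then $\operatorname{MRI}(K)\geq 4$ and $\operatorname{Reg}(K)\geq 5$.
   Context: For a knot diagram $D$, a region is a connected component of the complement in $S^2$ of the underlying projection of $D$ (crossing information forgotten). A region crossing change at a region $R$ changes every crossing in the boundary of $R$; $c(R)$ denotes the number of crossings in the boundary of $R$. A set of unknotting regions of $D$ is a set of regions such that performing region crossing changes at all of them yields a diagram of the unknot. $\operatorname{MRI}(D)$ is the minimum of $\sum_{j=1}^k c(R_{i_j})$ over all sets of unknotting regions $\{R_{i_1},\dots,R_{i_k}\}$ of $D$ (a crossing counted once for each region of the set containing it in its boundary), and $\operatorname{MRI}(K)$ is the minimum of $\operatorname{MRI}(D)$ over all diagrams $D$ of $K$. An unknotting region of $D$ is a single region $R$ such that the region crossing change at $R$ yields a diagram of the unknot. The region index $\operatorname{Reg}(D)$ is the minimum of $c(R)$ over all unknotting regions $R$ of $D$, and $\operatorname{Reg}(D)=\infty$ if $D$ has no unknotting region; $\operatorname{Reg}(K)$ is the minimum of $\operatorname{Reg}(D)$ over all diagrams $D$ of $K$. *)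

theory Defs
  imports "HOL-Analysis.Analysis" "HOL-Library.Extended_Nat"
begin

type_synonym point3 = "real \<times> real \<times> real"

definition proj :: "point3 \<Rightarrow> real \<times> real" where
  "proj p = (fst p, fst (snd p))"

definition height :: "point3 \<Rightarrow> real" where
  "height p = snd (snd p)"

definition pedge :: "point3 list \<Rightarrow> nat \<Rightarrow> point3 set" where
  "pedge vs i = closed_segment (vs ! i) (vs ! (Suc i mod length vs))"

definition pcurve :: "point3 list \<Rightarrow> point3 set" where
  "pcurve vs = (\<Union>i<length vs. pedge vs i)"

definition polygonal_knot :: "point3 list \<Rightarrow> bool" where
  "polygonal_knot vs \<longleftrightarrow> length vs \<ge> 3 \<and> distinct vs \<and>
     (\<forall>i<length vs. \<forall>j<length vs. i \<noteq> j \<longrightarrow>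
        pedge vs i \<inter> pedge vs j =
          (if j = Suc i mod length vs then {vs ! j}
           else if i = Suc j mod length vs then {vs ! i} else {}))"

definition ambient_isotopic :: "point3 set \<Rightarrow> point3 set \<Rightarrow> bool" where
  "ambient_isotopic A B \<longleftrightarrow>
     (\<exists>H :: real \<times> point3 \<Rightarrow> point3.
        continuous_on ({0..1} \<times> UNIV) H \<and>
        (\<forall>t\<in>{0..1}. \<exists>g. homeomorphism UNIV UNIV (\<lambda>x. H (t, x)) g) \<and>
        (\<forall>x. H (0, x) = x) \<and>
        (\<lambda>x. H (1, x)) ` A = B)"

definition std_unknot :: "point3 set" where
  "std_unknot = {(x, y, z). x\<^sup>2 + y\<^sup>2 = 1 \<and> z = 0}"

definition is_unknot :: "point3 set \<Rightarrow> bool" where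
  "is_unknot A \<longleftrightarrow> ambient_isotopic std_unknot A"

definition tame_knot :: "point3 set \<Rightarrow> bool" where
  "tame_knot K \<longleftrightarrow> (\<exists>vs. polygonal_knot vs \<and> ambient_isotopic (pcurve vs) K)"

definition crossings :: "point3 list \<Rightarrow> (real \<times> real) set" where
  "crossings vs = {q. \<exists>p1\<in>pcurve vs. \<exists>p2\<in>pcurve vs. p1 \<noteq> p2 \<and> proj p1 = q \<and> proj p2 = q}"

text \<open>Regular projection: no vertical edges, finitely many multiple points, each of
  which is a double point whose preimages are not vertices (hence transversal).\<close>

definition regular_proj :: "point3 list \<Rightarrow> bool" where
  "regular_proj vs \<longleftrightarrow>
     (\<forall>i<length vs. proj (vs ! i) \<noteq> proj (vs ! (Suc i mod length vs))) \<and>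
     finite (crossings vs) \<and>
     (\<forall>q\<in>crossings vs. card {p\<in>pcurve vs. proj p = q} = 2 \<and>
        (\<forall>p\<in>pcurve vs. proj p = q \<longrightarrow> p \<notin> set vs))"

text \<open>A knot diagram is a regular projection of a polygonal knot (with the
  over/under information given by the heights).\<close>

definition knot_diagram :: "point3 list \<Rightarrow> bool" where
  "knot_diagram vs \<longleftrightarrow> polygonal_knot vs \<and> regular_proj vs"

text \<open>Regions: components of the complement of the projected curve (the components
  in the plane correspond bijectively to those in the 2-sphere).\<close>

definition regions :: "point3 list \<Rightarrow> (real \<times> real) set set" where
  "regions vs = components (- (proj ` pcurve vs))"

definition creg :: "point3 list \<Rightarrow> (real \<times> real) set \<Rightarrow> nat" where
  "creg vs R = card {q \<in> crossings vs. q \<in> frontier R}"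

text \<open>Crossings changed by performing region crossing changes at all regions of S:
  a crossing is changed once for each region of S having it on its boundary.\<close>

definition changed_crossings :: "point3 list \<Rightarrow> (real \<times> real) set set \<Rightarrow> (real \<times> real) set" where
  "changed_crossings vs S = {q \<in> crossings vs. odd (card {R \<in> S. q \<in> frontier R})}"

text \<open>Changing the crossings in X yields a diagram of the unknot: the knot obtained
  by lifting the same projected curve with the crossing information switched exactly
  at the crossings in X is the unknot.\<close>

definition yields_unknot :: "point3 list \<Rightarrow> (real \<times> real) set \<Rightarrow> bool" where
  "yields_unknot vs X \<longleftrightarrow>
     (\<exists>h :: point3 \<Rightarrow> real. continuous_on (pcurve vs) h \<and>
        (\<forall>p1\<in>pcurve vs. \<forall>p2\<in>pcurve vs. proj p1 = proj p2 \<and> p1 \<noteq> p2 \<longrightarrow>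
           (h p1 < h p2 \<longleftrightarrow> ((height p1 < height p2) \<longleftrightarrow> proj p1 \<notin> X))) \<and>
        is_unknot ((\<lambda>p. (fst p, fst (snd p), h p)) ` pcurve vs))"

definition unknotting_regions :: "point3 list \<Rightarrow> (real \<times> real) set set \<Rightarrow> bool" where
  "unknotting_regions vs S \<longleftrightarrow> S \<subseteq> regions vs \<and> yields_unknot vs (changed_crossings vs S)"

definition MRI_D :: "point3 list \<Rightarrow> enat" where
  "MRI_D vs = (INF S \<in> {S. unknotting_regions vs S}. enat (\<Sum>R\<in>S. creg vs R))"

text \<open>Region index of a diagram (infinity if there is no unknotting region).\<close>

definition Reg_D :: "point3 list \<Rightarrow> enat" where
  "Reg_D vs = (INF R \<in> {R \<in> regions vs. unknotting_regions vs {R}}. enat (creg vs R))"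

definition MRI_K :: "point3 set \<Rightarrow> enat" where
  "MRI_K K = (INF vs \<in> {vs. knot_diagram vs \<and> ambient_isotopic (pcurve vs) K}. MRI_D vs)"

definition Reg_K :: "point3 set \<Rightarrow> enat" where
  "Reg_K K = (INF vs \<in> {vs. knot_diagram vs \<and> ambient_isotopic (pcurve vs) K}. Reg_D vs)"

end

theory Submission
  imports Defs
begin

text \<open>
  If \<open>MRI(K) < 4\<close>, take a diagram and a set \<open>S\<close> of unknotting regions realising \<open>MRI(K)\<close>. All
  regions of \<open>S\<close> but one meet at most one crossing. A region meeting exactly one crossing \<open>q\<close> changes
  a nugatory crossing, so it can be dropped from \<open>S\<close>, and a single unknotting region survives,
  giving \<open>Reg(K) \<le> MRI(K)\<close>; if \<open>S\<close> is empty, \<open>K\<close> is the unknot and \<open>Reg(K) = 0\<close>.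

  That \<open>q\<close> is nugatory is seen as follows. An edge of the diagram that meets the frontier of the
  region lies in it entirely, so both its ends are \<open>q\<close>: the curve contains a loop from \<open>q\<close> to \<open>q\<close>
  free of other crossings. No Schoenflies theorem is needed to remove the loop: lift it and a small
  collar above the rest of the knot as two strands that are monotone in the height and meet at a
  single top point over \<open>q\<close>. A level-preserving affine isotopy straightens these two strands into a
  cap that depends only on the end points of the collar. The top point can be either of the two
  preimages of \<open>q\<close>, and these two choices realise the two crossing informations at \<open>q\<close>.
\<close>

section \<open>Ambient isotopies\<close>

text \<open>\<open>yields_unknot\<close> asks for some continuous height with the right order at the
  crossings. The isotopy type of a lift depends only on that order, so heights may be chosen freely:
  the loop first gets its peak on the strand that is already on top at \<open>q\<close>, and the
  isotopy to the common cap is then run backwards towards a lift with its peak on the other strand.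
  Whatever the loop encloses stays at height at most 0 and is never touched, which is why nothing
  about the two sides of the loop has to be known.

  That the frontier follows a whole edge is a local matter: a disc slit along a ray from its centre
  is connected, so a frontier that stopped at a point other than a crossing would leave the region
  on all sides of that point, and the continuation of the curve would be frontier after all.

  The constant 4 is the least cost of two regions with at least two crossings each; below it at most
  one such region occurs. The bound 5 is the strict inequality read in the integers.\<close>

lemma ambient_isotopicI:
  fixes H :: "real \<times> point3 \<Rightarrow> point3" and G :: "real \<Rightarrow> point3 \<Rightarrow> point3"
  assumes "continuous_on ({0..1} \<times> UNIV) H"
    and "\<And>t. t \<in> {0..1} \<Longrightarrow> continuous_on UNIV (G t)"
    and "\<And>t x. t \<in> {0..1} \<Longrightarrow> G t (H (t, x)) = x"
    and "\<And>t x. t \<in> {0..1} \<Longrightarrow> H (t, G t x) = x"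
    and "\<And>x. H (0, x) = x" and "(\<lambda>x. H (1, x)) ` A = B"
  shows "ambient_isotopic A B"
proof -
  have "homeomorphism UNIV UNIV (\<lambda>x. H (t, x)) (G t)" if "t \<in> {0..1}" for t
  proof -
    have "continuous_on UNIV (\<lambda>x. H (t, x))"
      using that by (intro continuous_on_compose2[OF assms(1)] continuous_intros) auto
    moreover have "surj (\<lambda>x. H (t, x))" using assms(4)[OF that] by (metis surj_def)
    moreover have "surj (G t)" using assms(3)[OF that] by (metis surj_def)
    ultimately show ?thesis
      using assms(2-4) that by (auto simp: homeomorphism_def)
  qed
  then show ?thesis
    unfolding ambient_isotopic_def using assms(1,5,6)
    by (intro exI[of _ H] conjI ballI allI exI[of _ "G _"]) (simp_all del: split_paired_All)
qed

lemma ambient_isotopicE: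
  assumes "ambient_isotopic A B"
  obtains H :: "real \<times> point3 \<Rightarrow> point3" where "continuous_on ({0..1} \<times> UNIV) H"
    "\<forall>t\<in>{0..1}. \<exists>g. homeomorphism UNIV UNIV (\<lambda>x. H (t, x)) g"
    "\<forall>x. H (0, x) = x" "(\<lambda>x. H (1, x)) ` A = B"
  using assms unfolding ambient_isotopic_def by blast

lemma ambient_isotopic_trans:
  assumes "ambient_isotopic A B" "ambient_isotopic B C"
  shows "ambient_isotopic A C"
proof -
  from assms(1) obtain H :: "real \<times> point3 \<Rightarrow> point3" where H: "continuous_on ({0..1} \<times> UNIV) H"
    "\<forall>t\<in>{0..1}. \<exists>g. homeomorphism UNIV UNIV (\<lambda>x. H (t, x)) g"
    "\<forall>x. H (0, x) = x" "(\<lambda>x. H (1, x)) ` A = B"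
    by (rule ambient_isotopicE) (rule that)
  from assms(2) obtain H' :: "real \<times> point3 \<Rightarrow> point3" where H': "continuous_on ({0..1} \<times> UNIV) H'"
    "\<forall>t\<in>{0..1}. \<exists>g. homeomorphism UNIV UNIV (\<lambda>x. H' (t, x)) g"
    "\<forall>x. H' (0, x) = x" "(\<lambda>x. H' (1, x)) ` B = C"
    by (rule ambient_isotopicE) (rule that)
  \<comment> \<open>Both isotopies run simultaneously, so nothing has to be glued at an intermediate
    time.\<close>
  let ?K = "\<lambda>p. H' (fst p, H p)"
  have "continuous_on ({0..1} \<times> UNIV) ?K"
  proof (rule continuous_on_compose2[OF H'(1)])
    show "continuous_on ({0..1} \<times> UNIV) (\<lambda>p. (fst p, H p))"
      by (intro continuous_on_Pair continuous_on_fst continuous_on_id H(1))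
  qed auto
  moreover have "\<exists>g. homeomorphism UNIV UNIV (\<lambda>x. ?K (t, x)) g" if t: "t \<in> {0..1}" for t
  proof -
    obtain g g' where "homeomorphism UNIV UNIV (\<lambda>x. H (t, x)) g"
        "homeomorphism UNIV UNIV (\<lambda>x. H' (t, x)) g'"
      using bspec[OF H(2) t] bspec[OF H'(2) t] by (elim exE) (rule that)
    from homeomorphism_compose[OF this] show ?thesis by (auto simp: o_def)
  qed
  moreover have "(\<lambda>x. ?K (1, x)) ` A = (\<lambda>x. H' (1, x)) ` (\<lambda>x. H (1, x)) ` A"
    by (simp add: image_image)
  ultimately show ?thesis
    unfolding ambient_isotopic_def using H(3,4) H'(3,4) by (intro exI[of _ ?K]) auto
qed

lemma ambient_isotopic_sym:
  assumes "ambient_isotopic A B"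
  shows "ambient_isotopic B A"
proof -
  from assms obtain H :: "real \<times> point3 \<Rightarrow> point3" where H: "continuous_on ({0..1} \<times> UNIV) H"
    "\<forall>t\<in>{0..1}. \<exists>g. homeomorphism UNIV UNIV (\<lambda>x. H (t, x)) g"
    "\<forall>x. H (0, x) = x" "(\<lambda>x. H (1, x)) ` A = B"
    by (rule ambient_isotopicE) (rule that)
  obtain g where g: "homeomorphism UNIV UNIV (\<lambda>x. H (1, x)) g"
    using H(2) by force
  have gc: "continuous_on UNIV g" using g by (simp add: homeomorphism_def)
  \<comment> \<open>The isotopy is run backwards, after undoing its end map so that it starts at the
    identity.\<close>
  let ?K = "\<lambda>p. H (1 - fst p, g (snd p))"
  have "continuous_on ({0..1} \<times> UNIV) ?K"
  proof (rule continuous_on_compose2[OF H(1)])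
    show "continuous_on ({0..1} \<times> UNIV) (\<lambda>p::real \<times> point3. (1 - fst p, g (snd p)))"
      by (intro continuous_intros continuous_on_compose2[OF gc]) auto
  qed auto
  moreover have "\<exists>f. homeomorphism UNIV UNIV (\<lambda>x. ?K (t, x)) f" if t: "t \<in> {0..1}" for t
  proof -
    obtain f where "homeomorphism UNIV UNIV (\<lambda>x. H (1 - t, x)) f"
      using bspec[OF H(2), of "1 - t"] t by auto
    from homeomorphism_compose[OF homeomorphism_symD[OF g] this]
    show ?thesis by (auto simp: o_def)
  qed
  moreover have "(\<lambda>x. ?K (1, x)) ` B = A"
    unfolding H(4)[symmetric] image_image using H(3) homeomorphism_apply1[OF g]
    by (simp del: split_paired_All)
  moreover have "?K (0, x) = x" for x using homeomorphism_apply2[OF g] by simp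
  ultimately show ?thesis
    unfolding ambient_isotopic_def by (intro exI[of _ ?K]) auto
qed

lemma is_unknot_cong: "is_unknot A \<Longrightarrow> ambient_isotopic A B \<Longrightarrow> is_unknot B"
  unfolding is_unknot_def by (rule ambient_isotopic_trans)

text \<open>Writing the vertical factor as \<open>exp l\<close> makes it positive, and
  \<open>exp (t * l)\<close> joins it to 1 through positive factors; every stage is therefore an
  invertible affine map on each vertical line.\<close>

lemma vertical_affine_isotopic:
  fixes l f :: "real \<times> real \<Rightarrow> real"
  assumes l: "continuous_on UNIV l" and f: "continuous_on UNIV f"
    and B: "(\<lambda>(x, y, z). (x, y, exp (l (x, y)) * z + f (x, y))) ` A = B"
  shows "ambient_isotopic A B"
proof (rule ambient_isotopicI[where
      H = "\<lambda>(t, x, y, z). (x, y, exp (t * l (x, y)) * z + t * f (x, y))" and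
      G = "\<lambda>t (x, y, z). (x, y, exp (- (t * l (x, y))) * (z - t * f (x, y)))"])
  show "continuous_on ({0..1} \<times> UNIV)
      (\<lambda>(t, x, y, z). (x, y, exp (t * l (x, y)) * z + t * f (x, y)))"
    unfolding case_prod_unfold
    by (intro continuous_intros continuous_on_compose2[OF l] continuous_on_compose2[OF f]) auto
  show "continuous_on UNIV (\<lambda>(x, y, z). (x, y, exp (- (t * l (x, y))) * (z - t * f (x, y))))" for t
    unfolding case_prod_unfold
    by (intro continuous_intros continuous_on_compose2[OF l] continuous_on_compose2[OF f]) auto
qed (use B in \<open>auto simp: exp_minus field_simps\<close>)

definition spatial :: "complex \<Rightarrow> real \<Rightarrow> point3" where
  "spatial w z = (Re w, Im w, z)"

text \<open>The analogue for horizontal planes: with complex coordinates a rotation and dilation at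
  level \<open>z\<close> is multiplication by \<open>exp (g z)\<close>, which never vanishes and is
  joined to 1 by scaling the exponent.\<close>

lemma horizontal_affine_isotopic:
  fixes g r :: "real \<Rightarrow> complex"
  assumes g: "continuous_on UNIV g" and r: "continuous_on UNIV r"
    and B: "(\<lambda>(x, y, z). spatial (exp (g z) * Complex x y + r z) z) ` A = B"
  shows "ambient_isotopic A B"
proof -
  define H where "H = (\<lambda>(t, x, y, z). spatial (exp (of_real t * g z) * Complex x y + of_real t * r z) z)"
  define G where "G = (\<lambda>t (x, y, z).
    spatial (exp (- (of_real t * g z)) * (Complex x y - of_real t * r z)) z)"
  have cancel: "exp (- w) * (exp w * v) = v" "exp w * (exp (- w) * v) = v" for v w :: complex
    by (simp_all add: exp_minus)
  have eta: "Complex (Re u) (Im u) = u" for u by simp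
  have "continuous_on ({0..1} \<times> UNIV) H"
    unfolding H_def case_prod_unfold spatial_def Complex_eq
    by (intro continuous_intros continuous_on_compose2[OF g] continuous_on_compose2[OF r]) auto
  moreover have "continuous_on UNIV (G t)" for t
    unfolding G_def case_prod_unfold spatial_def Complex_eq
    by (intro continuous_intros continuous_on_compose2[OF g] continuous_on_compose2[OF r]) auto
  moreover have "G t (H (t, x)) = x" "H (t, G t x) = x" for t x
    by (cases x, simp only: H_def G_def spatial_def case_prod_conv eta
         add_diff_cancel_right' diff_add_cancel cancel complex.sel)+
  moreover have "H (0, x) = x" for x by (cases x) (simp add: H_def spatial_def)
  moreover have "(\<lambda>x. H (1, x)) ` A = B"
    unfolding B[symmetric] by (simp add: H_def case_prod_unfold)
  ultimately show ?thesis by (intro ambient_isotopicI[of H G])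
qed

text \<open>A continuous map from a compact space to a Hausdorff space is closed, hence a quotient
  map onto its image. This turns functions of the parameter into functions on the knot, and
  functions on the knot into functions of the projection.\<close>

lemma continuous_on_factor_compact:
  fixes f :: "'a::t2_space \<Rightarrow> 'b::t2_space" and g :: "'a \<Rightarrow> 'c::topological_space"
  assumes "compact S" and f: "continuous_on S f" and g: "continuous_on S g"
    and eq: "\<And>x y. x \<in> S \<Longrightarrow> y \<in> S \<Longrightarrow> f x = f y \<Longrightarrow> g x = g y"
  obtains h where "continuous_on (f ` S) h" "\<And>x. x \<in> S \<Longrightarrow> h (f x) = g x"
proof -
  define h where "h = (\<lambda>y. g (SOME x. x \<in> S \<and> f x = y))"
  have h: "h (f x) = g x" if "x \<in> S" for x
  proof -
    have "(SOME x'. x' \<in> S \<and> f x' = f x) \<in> S \<and> f (SOME x'. x' \<in> S \<and> f x' = f x) = f x"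
      by (rule someI[of _ x]) (use that in auto)
    then show ?thesis unfolding h_def using eq that by blast
  qed
  have "continuous_on (f ` S) h"
    unfolding continuous_on_closed_vimage[OF compact_imp_closed[OF compact_continuous_image[OF f assms(1)]]]
  proof (intro allI impI)
    fix B :: "'c set" assume "closed B"
    then have "closed (g -` B \<inter> S)"
      using g assms(1) continuous_on_closed_vimage compact_imp_closed by blast
    then have "compact (S \<inter> (g -` B \<inter> S))" using assms(1) by (simp add: compact_Int_closed)
    then have "compact (f ` (S \<inter> (g -` B \<inter> S)))"
      by (rule compact_continuous_image[rotated]) (rule continuous_on_subset[OF f], auto)
    moreover have "f ` (S \<inter> (g -` B \<inter> S)) = h -` B \<inter> f ` S" using h by auto
    ultimately show "closed (h -` B \<inter> f ` S)" using compact_imp_closed by force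
  qed
  with h that show thesis by blast
qed

section \<open>Lifts of a projected curve with a prescribed order at the crossings\<close>

definition lift :: "(point3 \<Rightarrow> real) \<Rightarrow> point3 \<Rightarrow> point3" where
  "lift h p = (fst p, fst (snd p), h p)"

lemma continuous_on_proj: "continuous_on S proj"
  unfolding proj_def by (intro continuous_intros)

text \<open>The gaps at the finitely many crossings are first rescaled by a positive factor depending
  only on the projection; the remaining difference of heights is then a function of the projection.\<close>

lemma lift_isotopic:
  fixes C :: "point3 set"
  defines "Q \<equiv> {q. \<exists>p1\<in>C. \<exists>p2\<in>C. p1 \<noteq> p2 \<and> proj p1 = q \<and> proj p2 = q}"
  assumes C: "compact C" and h0: "continuous_on C h0" and h1: "continuous_on C h1"
    and Q: "finite Q" "\<And>q. q \<in> Q \<Longrightarrow> card {p \<in> C. proj p = q} = 2"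
    and order: "\<And>p1 p2. p1 \<in> C \<Longrightarrow> p2 \<in> C \<Longrightarrow> proj p1 = proj p2 \<Longrightarrow> p1 \<noteq> p2 \<Longrightarrow>
      h0 p1 < h0 p2 \<and> h1 p1 < h1 p2 \<or> h0 p2 < h0 p1 \<and> h1 p2 < h1 p1"
  shows "ambient_isotopic (lift h0 ` C) (lift h1 ` C)"
proof -
  have "\<exists>l. \<forall>p1\<in>C. \<forall>p2\<in>C. proj p1 = q \<longrightarrow> proj p2 = q \<longrightarrow>
      h1 p2 - h1 p1 = exp l * (h0 p2 - h0 p1)" if qQ: "q \<in> Q" for q
  proof -
    obtain a b where ab: "{p \<in> C. proj p = q} = {a, b}" "a \<noteq> b"
      using Q(2)[OF qQ] unfolding card_2_iff by blast
    \<comment> \<open>Both heights order the two points over \<open>q\<close> alike, so the quotient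
      is positive and has a logarithm.\<close>
    define l where "l = ln ((h1 b - h1 a) / (h0 b - h0 a))"
    have "a \<in> C" "b \<in> C" "proj a = proj b" using ab by (smt (verit) insertCI mem_Collect_eq)+
    from order[OF this ab(2)] have o: "(h1 b - h1 a) / (h0 b - h0 a) > 0" "h0 b - h0 a \<noteq> 0"
      by (auto simp: divide_pos_pos divide_neg_neg)
    have l: "h1 b - h1 a = exp l * (h0 b - h0 a)"
      using o unfolding l_def by (subst exp_ln) auto
    have "h1 p2 - h1 p1 = exp l * (h0 p2 - h0 p1)"
      if "p1 \<in> C" "p2 \<in> C" "proj p1 = q" "proj p2 = q" for p1 p2
    proof -
      have "p1 \<in> {a, b}" "p2 \<in> {a, b}" using that ab by blast+
      then show ?thesis using l by (auto simp: algebra_simps)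
    qed
    then show ?thesis by blast
  qed
  then obtain l0 where l0: "\<And>q p1 p2. q \<in> Q \<Longrightarrow> p1 \<in> C \<Longrightarrow> p2 \<in> C \<Longrightarrow> proj p1 = q \<Longrightarrow>
      proj p2 = q \<Longrightarrow> h1 p2 - h1 p1 = exp (l0 q) * (h0 p2 - h0 p1)"
    by metis
  \<comment> \<open>Any function on a finite set is continuous, so the logarithms prescribed at the
    crossings extend to the plane.\<close>
  obtain l :: "real \<times> real \<Rightarrow> real" where l: "continuous_on UNIV l" "\<And>q. q \<in> Q \<Longrightarrow> l q = l0 q"
    using Tietze_unbounded[of Q l0 UNIV] continuous_on_finite[OF Q(1)] finite_imp_closed[OF Q(1)]
    by auto
  have lc: "continuous_on C (\<lambda>p. l (proj p))"
    by (rule continuous_on_compose2[OF l(1) continuous_on_proj]) auto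
  have cont: "continuous_on C (\<lambda>p. h1 p - exp (l (proj p)) * h0 p)"
    by (intro continuous_intros h0 h1 lc)
  have eq: "h1 x - exp (l (proj x)) * h0 x = h1 y - exp (l (proj y)) * h0 y"
    if xy: "x \<in> C" "y \<in> C" "proj x = proj y" for x y
    proof (cases "x = y")
      case False
      have q: "proj x \<in> Q"
        unfolding Q_def mem_Collect_eq
        by (rule bexI[OF bexI[OF _ xy(2)] xy(1)]) (use False xy(3) in simp)
      have "h1 y - h1 x = exp (l (proj x)) * (h0 y - h0 x)"
        unfolding l(2)[OF q] by (rule l0[OF q xy(1,2) refl xy(3)[symmetric]])
      then show ?thesis unfolding xy(3) right_diff_distrib by linarith
    qed simp
  obtain f0 where f0: "continuous_on (proj ` C) f0"
      "\<And>p. p \<in> C \<Longrightarrow> f0 (proj p) = h1 p - exp (l (proj p)) * h0 p"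
    using continuous_on_factor_compact[OF C continuous_on_proj cont eq] by blast
  have "closed (proj ` C)"
    by (rule compact_imp_closed[OF compact_continuous_image[OF continuous_on_proj C]])
  then obtain f :: "real \<times> real \<Rightarrow> real" where f: "continuous_on UNIV f"
      "\<And>q. q \<in> proj ` C \<Longrightarrow> f q = f0 q"
    using Tietze_unbounded[OF f0(1), of UNIV] by auto
  show ?thesis
  proof (rule vertical_affine_isotopic[OF l(1) f(1)])
    have "(case lift h0 p of (x, y, z) \<Rightarrow> (x, y, exp (l (x, y)) * z + f (x, y))) = lift h1 p"
      if "p \<in> C" for p
      using f(2)[of "proj p"] f0(2)[OF that] that by (simp add: lift_def proj_def)
    then show "(\<lambda>(x, y, z). (x, y, exp (l (x, y)) * z + f (x, y))) ` lift h0 ` C = lift h1 ` C"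
      by (simp add: image_image)
  qed
qed

section \<open>Straightening two strands that meet at a top point\<close>

definition clamp01 :: "real \<Rightarrow> real" where "clamp01 z = max 0 (min 1 z)"

text \<open>Extends data given for the heights of the strands to all heights, constantly below 0 and
  above 1.\<close>

lemma continuous_on_clamp01:
  assumes "continuous_on {0..1} f"
  shows "continuous_on UNIV (\<lambda>z. f (clamp01 z))"
  by (rule continuous_on_compose2[OF assms]) (auto simp: clamp01_def intro!: continuous_intros)

text \<open>The isotopy is \<open>w \<mapsto> exp (g z) w + r z\<close> at level \<open>z\<close>. Near the top the difference of the strands
  is a multiple of \<open>1 - z\<close>, so its quotient by \<open>1 - z\<close> has a continuous logarithm on the whole of
  \<open>[0, 1]\<close>.\<close>

lemma cap_isotopic:
  fixes p1 p2 :: "real \<Rightarrow> complex"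
  assumes p1: "continuous_on {0..1} p1" and p2: "continuous_on {0..1} p2"
    and ne: "\<And>z. 0 \<le> z \<Longrightarrow> z < 1 \<Longrightarrow> p1 z \<noteq> p2 z"
    and e: "e \<noteq> 0" and d: "0 < d" "d \<le> 1"
    and top: "\<And>z. 1 - d \<le> z \<Longrightarrow> z \<le> 1 \<Longrightarrow> p1 z - p2 z = of_real (1 - z) * e"
    and B: "\<And>x y z. (x, y, z) \<in> B \<Longrightarrow> z \<le> 0"
  shows "ambient_isotopic
     (B \<union> (\<lambda>z. spatial (p1 z) z) ` {0..1} \<union> (\<lambda>z. spatial (p2 z) z) ` {0..1})
     (B \<union> (\<lambda>z. spatial (of_real (1 - z) * p1 0) z) ` {0..1} \<union>
          (\<lambda>z. spatial (of_real (1 - z) * p2 0) z) ` {0..1})"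
proof -
  define D where "D = (\<lambda>z. if z \<le> 1 - d then (p1 z - p2 z) / of_real (1 - z) else e)"
  have D: "p1 z - p2 z = of_real (1 - z) * D z" if "0 \<le> z" "z \<le> 1" for z
    using top[of z] that d by (auto simp: D_def field_simps simp flip: of_real_diff)
  have D0: "D z \<noteq> 0" if "z \<in> {0..1}" for z
    using ne[of z] e d that by (auto simp: D_def simp flip: of_real_diff)
  have "continuous_on {0..1} D"
    unfolding D_def
  proof (rule continuous_on_cases_le)
    have "continuous_on {0..1 - d} (\<lambda>z. (p1 z - p2 z) / of_real (1 - z))"
      by (intro continuous_intros continuous_on_subset[OF p1] continuous_on_subset[OF p2])
         (use d in auto)
    then show "continuous_on {z \<in> {0..1}. z \<le> 1 - d} (\<lambda>z. (p1 z - p2 z) / of_real (1 - z))"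
      by (rule continuous_on_subset) auto
    fix z assume "z \<in> {0..1}" "z = 1 - d"
    then show "(p1 z - p2 z) / of_real (1 - z) = e"
      using top[of z] d by simp
  qed (auto intro!: continuous_intros)
  then obtain L where L: "continuous_on {0..1} L" "\<And>z. z \<in> {0..1} \<Longrightarrow> D z = exp (L z)"
    by (rule continuous_logarithm_on_contractible[OF _ convex_imp_contractible])
       (use D0 in auto)
  \<comment> \<open>Multiplication by \<open>exp (g z)\<close> turns \<open>D z\<close> into the
    constant \<open>D 0\<close>, so the difference of the strands becomes linear in
    \<open>z\<close>. The translation \<open>r\<close> then straightens the first strand, and the
    second follows. Both \<open>g\<close> and \<open>r\<close> vanish at 0, so after clamping
    everything at height at most 0 stays fixed.\<close>
  define g where "g = (\<lambda>z. L 0 - L z)"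
  have gD: "exp (g z) * D z = D 0" if "z \<in> {0..1}" for z
    unfolding L(2)[OF that] g_def using L(2)[of 0] by (simp flip: exp_add)
  define r where "r = (\<lambda>z. of_real (1 - z) * p1 0 - exp (g z) * p1 z)"
  have g: "continuous_on {0..1} g" unfolding g_def by (intro continuous_intros L)
  have r: "continuous_on {0..1} r" unfolding r_def by (intro continuous_intros g p1)
  have m1: "exp (g z) * p1 z + r z = of_real (1 - z) * p1 0" for z by (simp add: r_def)
  have m2: "exp (g z) * p2 z + r z = of_real (1 - z) * p2 0" if "0 \<le> z" "z \<le> 1" for z
  proof -
    have "exp (g z) * p2 z + r z = of_real (1 - z) * p1 0 - exp (g z) * (p1 z - p2 z)"
      by (simp add: r_def algebra_simps)
    also have "exp (g z) * (p1 z - p2 z) = of_real (1 - z) * D 0"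
      using D[OF that] gD[of z] that by simp
    also have "D 0 = p1 0 - p2 0" using D[of 0] by simp
    finally show ?thesis by (simp add: algebra_simps)
  qed
  let ?f = "\<lambda>(x, y, z). spatial (exp (g (clamp01 z)) * Complex x y + r (clamp01 z)) z"
  have "?f p = p" if "p \<in> B" for p
  proof (cases p)
    case (fields x y z)
    then have "clamp01 z = 0" using B[of x y z] that by (auto simp: clamp01_def)
    then show ?thesis by (simp add: fields g_def r_def spatial_def)
  qed
  then have fB: "?f ` B = B" by force
  have f: "?f (spatial w z) = spatial (exp (g z) * w + r z) z" if "0 \<le> z" "z \<le> 1" for w z
  proof -
    have "clamp01 z = z" using that by (simp add: clamp01_def)
    then show ?thesis by (simp add: spatial_def)
  qed
  have f1: "?f ` (\<lambda>z. spatial (p1 z) z) ` {0..1} = (\<lambda>z. spatial (of_real (1 - z) * p1 0) z) ` {0..1}"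
    unfolding image_image by (intro image_cong refl) (simp only: atLeastAtMost_iff f m1)
  have f2: "?f ` (\<lambda>z. spatial (p2 z) z) ` {0..1} = (\<lambda>z. spatial (of_real (1 - z) * p2 0) z) ` {0..1}"
    unfolding image_image by (intro image_cong refl) (simp only: atLeastAtMost_iff f m2)
  show ?thesis
    by (rule horizontal_affine_isotopic[OF continuous_on_clamp01[OF g] continuous_on_clamp01[OF r]])
       (simp only: image_Un fB f1 f2)
qed

section \<open>Frontiers of regions\<close>

text \<open>The ball without the ray is connected, meets \<open>R\<close> and avoids its frontier,
  so it lies in \<open>R\<close>; the ray has empty interior, so passing to closures recovers the
  whole ball.\<close>

lemma ball_subset_closure_if_frontier_on_ray:
  fixes x u :: "real \<times> real"
  assumes R: "open R" and x: "x \<in> frontier R" and r: "0 < r" and u: "u \<noteq> 0"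
    and ray: "frontier R \<inter> ball x r \<subseteq> {x + t *\<^sub>R u | t. 0 \<le> t}"
  shows "ball x r \<subseteq> closure R"
proof -
  define L where "L = {x + t *\<^sub>R u | t. 0 \<le> t}"
  define E where "E = ball x r - L"
  \<comment> \<open>A normal of \<open>u\<close>: the ray lies on a line, which has empty
    interior.\<close>
  let ?a = "(snd u, - fst u)"
  have "?a \<noteq> 0" using u by (auto simp: prod_eq_iff)
  moreover have "L \<subseteq> {y. ?a \<bullet> y = ?a \<bullet> x}"
    by (auto simp: L_def inner_prod_def algebra_simps)
  ultimately have intL: "interior L = {}"
    by (metis interior_hyperplane interior_mono subset_empty)
  have "starlike E"
    unfolding starlike_def
  proof
    \<comment> \<open>A point of the ball opposite to the ray. Prolonging a segment from
      \<open>p\<close> beyond a point of \<open>L\<close> stays in \<open>L\<close>, so every point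
      of the ball off \<open>L\<close> is visible from \<open>p\<close>.\<close>
    define p where "p = x - (r / (2 * norm u)) *\<^sub>R u"
    have pL: "p \<notin> L"
    proof
      assume "p \<in> L"
      then obtain t where t: "0 \<le> t" "x - (r / (2 * norm u)) *\<^sub>R u = x + t *\<^sub>R u"
        by (auto simp: L_def p_def)
      have "(t + r / (2 * norm u)) *\<^sub>R u = (x + t *\<^sub>R u) - (x - (r / (2 * norm u)) *\<^sub>R u)"
        by (simp add: algebra_simps)
      also have "\<dots> = 0" using t(2) by simp
      finally have "t + r / (2 * norm u) = 0" using u by simp
      moreover have "r / (2 * norm u) > 0" using r u by simp
      ultimately show False using t(1) by linarith
    qed
    have pb: "p \<in> ball x r" using r u by (simp add: p_def dist_norm)
    show "p \<in> E" using pL pb by (simp add: E_def)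
    show "\<forall>y\<in>E. closed_segment p y \<subseteq> E"
    proof (intro ballI subsetI)
      fix y z assume y: "y \<in> E" and z: "z \<in> closed_segment p y"
      have "z \<in> ball x r"
        using closed_segment_subset[OF pb _ convex_ball, of y] y z by (auto simp: E_def)
      moreover have "z \<notin> L"
      proof
        assume "z \<in> L"
        then obtain t where t: "0 \<le> t" "z = x + t *\<^sub>R u" by (auto simp: L_def)
        obtain v where v: "0 \<le> v" "v \<le> 1" "z = (1 - v) *\<^sub>R p + v *\<^sub>R y"
          using z by (auto simp: in_segment)
        have v0: "v > 0" using v t pL \<open>z \<in> L\<close> by (cases "v = 0") auto
        have "v *\<^sub>R (y - x) = (z - x) - (1 - v) *\<^sub>R (p - x)"
          by (simp add: v algebra_simps)
        also have "\<dots> = (t + (1 - v) * (r / (2 * norm u))) *\<^sub>R u"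
          by (simp add: t p_def algebra_simps)
        finally have w: "v *\<^sub>R (y - x) = (t + (1 - v) * (r / (2 * norm u))) *\<^sub>R u" .
        have "y = x + (1 / v) *\<^sub>R (v *\<^sub>R (y - x))" using v0 by simp
        also have "\<dots> = x + ((t + (1 - v) * (r / (2 * norm u))) / v) *\<^sub>R u"
          unfolding w by simp
        finally have "y = x + ((t + (1 - v) * (r / (2 * norm u))) / v) *\<^sub>R u" .
        moreover have "0 \<le> (t + (1 - v) * (r / (2 * norm u))) / v" using t(1) v r by auto
        ultimately have "y \<in> L" unfolding L_def by blast
        then show False using y by (simp add: E_def)
      qed
      ultimately show "z \<in> E" by (simp add: E_def)
    qed
  qed
  then have "connected E" by (rule starlike_imp_connected)
  moreover have "E \<inter> R \<noteq> {}"
  proof -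
    have "x \<in> closure R" using x by (simp add: frontier_def)
    then have "R \<inter> ball x r \<noteq> {}"
      using r by (metis centre_in_ball disjoint_iff open_Int_closure_eq_empty open_ball inf_commute)
    then have "\<not> R \<inter> ball x r \<subseteq> L"
      using intL R by (metis interior_maximal open_Int open_ball subset_empty)
    then show ?thesis by (auto simp: E_def)
  qed
  moreover have "E \<inter> frontier R = {}" using ray by (auto simp: E_def L_def)
  ultimately have "E \<subseteq> R" using connected_Int_frontier[of E R] by blast
  have "closure (- L) = UNIV" using intL by (simp add: closure_complement)
  then have "closure (ball x r \<inter> - L) = closure (ball x r)"
    by (intro closure_open_Int_superset) auto
  then have "ball x r \<subseteq> closure E"
    using closure_subset[of "ball x r"] by (simp add: E_def Diff_eq)
  also have "\<dots> \<subseteq> closure R" using \<open>E \<subseteq> R\<close> by (rule closure_mono)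
  finally show ?thesis .
qed

lemma ex_shift_in_interval:
  fixes N :: real
  assumes "0 < N"
  obtains k :: int where "A \<le> t + of_int k * N" "t + of_int k * N < A + N"
proof
  let ?f = "\<lfloor>(t - A) / N\<rfloor>"
  have "of_int ?f * N \<le> t - A" "t - A < (of_int ?f + 1) * N"
    by (rule floor_divide_lower[OF assms], rule floor_divide_upper[OF assms])
  then show "A \<le> t + of_int (- ?f) * N" "t + of_int (- ?f) * N < A + N"
    by (simp_all add: algebra_simps)
qed

text \<open>If the frontier stopped at \<open>a s\<close>, then near \<open>a s\<close> it would lie
  on the straight piece arriving there, and the whole ball would lie in the closure of
  \<open>R\<close>. The curve just after \<open>s\<close> would then lie in the closure but not in
  \<open>R\<close>, hence in the frontier. The hypothesis \<open>inj\<close> says that no other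
  strand passes through \<open>a s\<close>.\<close>

lemma frontier_param_right_limit:
  fixes a :: "real \<Rightarrow> real \<times> real"
  assumes a: "continuous_on UNIV a" and N: "0 < N"
    and per: "\<And>t (k::int). a (t + of_int k * N) = a t"
    and inj: "\<And>t. a t = a s \<Longrightarrow> \<exists>k::int. t = s + of_int k * N"
    and d: "0 < d" and u: "u \<noteq> 0"
    and left: "\<And>x. 0 \<le> x \<Longrightarrow> x \<le> d \<Longrightarrow> a (s - x) = a s + x *\<^sub>R u"
    and R: "R \<in> components (- range a)" and cl: "closed (range a)"
    and s: "a s \<in> frontier R" and \<delta>: "0 < \<delta>"
  shows "\<exists>t. s < t \<and> t < s + \<delta> \<and> a t \<in> frontier R"
proof (rule ccontr)
  assume none: "\<not> ?thesis"
  \<comment> \<open>At most \<open>d\<close>, so that the window is straight to the left of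
    \<open>s\<close>; at most \<open>N / 2\<close>, so that the complementary arc ends no earlier
    than it begins.\<close>
  define e where "e = Min {\<delta>, d, N / 2}"
  have e: "0 < e" "e \<le> \<delta>" "e \<le> d" "e \<le> N / 2" using \<delta> d N by (auto simp: e_def)
  have openR: "open R" using R cl open_components by blast
  have fR: "frontier R \<subseteq> range a"
    by (rule frontier_of_components_closed_complement[OF cl R])
  have RR: "R \<inter> range a = {}" using in_components_subset[OF R] by blast
  \<comment> \<open>The curve outside the window around \<open>s\<close>: it is compact and misses
    \<open>a s\<close>, so a small ball around \<open>a s\<close> sees only the window.\<close>
  define K where "K = a ` {s + e..s - e + N}"
  have "compact K"
    unfolding K_def by (rule compact_continuous_image[OF continuous_on_subset[OF a]]) auto
  moreover have "a s \<notin> K"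
  proof
    assume "a s \<in> K"
    then obtain t where t: "s + e \<le> t" "t \<le> s - e + N" "a t = a s" by (auto simp: K_def)
    obtain k :: int where k: "t = s + of_int k * N" using inj[OF t(3)] by blast
    have "0 * N < of_int k * N" "of_int k * N < 1 * N" using k t(1,2) e(1) by linarith+
    then have "0 < k" "k < 1" unfolding mult_less_cancel_right_pos[OF N] by simp_all
    then show False by simp
  qed
  ultimately obtain r where "0 < r" "ball (a s) r \<subseteq> - K"
    using openE[of "- K" "a s"] compact_imp_closed[of K] open_Compl by blast
  then have r: "0 < r" "ball (a s) r \<inter> K = {}" by auto
  have "ball (a s) r \<subseteq> closure R"
  proof (rule ball_subset_closure_if_frontier_on_ray[OF openR s r(1) u])
    show "frontier R \<inter> ball (a s) r \<subseteq> {a s + t *\<^sub>R u | t. 0 \<le> t}"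
    proof
      fix y assume y: "y \<in> frontier R \<inter> ball (a s) r"
      then obtain t0 where "y = a t0" using fR by blast
      moreover obtain k :: int where "s - e \<le> t0 + of_int k * N" "t0 + of_int k * N < s - e + N"
        using ex_shift_in_interval[OF N] .
      ultimately obtain t where t: "y = a t" "s - e \<le> t" "t < s - e + N" using per by metis
      have "y \<notin> K" using y r(2) by blast
      then have "t < s + e" using t unfolding K_def by (metis atLeastAtMost_iff image_eqI less_eq_real_def not_less)
      moreover have "\<not> (s < t \<and> t < s + e)" using none y t e(2) by auto
      ultimately have "t \<le> s" by linarith
      then have "y = a s + (s - t) *\<^sub>R u" using left[of "s - t"] t e by simp
      then show "y \<in> {a s + t *\<^sub>R u | t. 0 \<le> t}" using \<open>t \<le> s\<close> by force
    qed
  qed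
  moreover have "\<exists>t. s < t \<and> t < s + \<delta> \<and> a t \<in> ball (a s) r"
  proof -
    have "isCont a s" using a by (simp add: continuous_on_eq_continuous_at)
    then obtain \<eta> where \<eta>: "0 < \<eta>" "\<And>t. dist t s < \<eta> \<Longrightarrow> dist (a t) (a s) < r"
      using r(1) unfolding continuous_at_eps_delta by blast
    have "dist (s + min \<eta> \<delta> / 2) s < \<eta>" using \<eta>(1) \<delta> by (auto simp: dist_real_def)
    from \<eta>(2)[OF this] show ?thesis
      using \<eta>(1) \<delta> by (intro exI[of _ "s + min \<eta> \<delta> / 2"]) (auto simp: dist_commute)
  qed
  ultimately obtain t where t: "s < t" "t < s + \<delta>" "a t \<in> closure R" by blast
  have "a t \<in> frontier R" using t(3) RR openR by (auto simp: frontier_def interior_open)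
  with none t show False by blast
qed

text \<open>Continuous induction: the supremum of \<open>T\<close> within \<open>[s, e]\<close>
  belongs to \<open>T\<close>, and if it were below \<open>e\<close>, then \<open>lim\<close> would
  push it further.\<close>

lemma closed_right_limits_reach:
  fixes T :: "real set"
  assumes T: "closed T" and s: "s \<in> T" "s < e"
    and lim: "\<And>m. m \<in> T \<Longrightarrow> s \<le> m \<Longrightarrow> m < e \<Longrightarrow> \<exists>t\<in>T. m < t \<and> t < e"
  shows "e \<in> T"
proof (rule ccontr)
  assume "e \<notin> T"
  let ?S = "T \<inter> {s..e}"
  have ne: "?S \<noteq> {}" and bdd: "bdd_above ?S" using s by auto
  have "Sup ?S \<in> ?S" using T by (intro closed_contains_Sup ne bdd) auto
  moreover from this \<open>e \<notin> T\<close> have "Sup ?S < e" by (metis IntD1 IntD2 atLeastAtMost_iff less_eq_real_def)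
  ultimately obtain t where "t \<in> T" "Sup ?S < t" "t < e" using lim[of "Sup ?S"] by auto
  moreover from this \<open>Sup ?S \<in> ?S\<close> have "t \<in> ?S" by auto
  ultimately show False using cSup_upper[OF _ bdd, of t] by simp
qed

lemma closed_left_limits_reach:
  fixes T :: "real set"
  assumes T: "closed T" and s: "s \<in> T" "e < s"
    and lim: "\<And>m. m \<in> T \<Longrightarrow> m \<le> s \<Longrightarrow> e < m \<Longrightarrow> \<exists>t\<in>T. e < t \<and> t < m"
  shows "e \<in> T"
proof -
  have cl: "closed (uminus ` T)" using T by (rule closed_negations)
  have lim': "\<exists>t\<in>uminus ` T. m < t \<and> t < - e" if "m \<in> uminus ` T" "- s \<le> m" "m < - e" for m
  proof -
    have "- m \<in> T" "- m \<le> s" "e < - m" using that by auto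
    from lim[OF this] obtain t where "t \<in> T" "e < t" "t < - m" by blast
    then show ?thesis by (intro bexI[of _ "- t"]) auto
  qed
  have "- s \<in> uminus ` T" "- s < - e" using s by auto
  from closed_right_limits_reach[OF cl this lim'] have "- e \<in> uminus ` T" by blast
  then show ?thesis by auto
qed

section \<open>Finiteness of the set of regions\<close>

text \<open>A component contains a point off the hyperplanes, and the signs of the hyperplanes at that
  point determine the component.\<close>

lemma finite_components_Compl_subset_hyperplanes:
  fixes V :: "('a::euclidean_space \<times> real) set"
  assumes V: "finite V" "\<And>a b. (a, b) \<in> V \<Longrightarrow> a \<noteq> 0"
    and X: "closed X" "X \<subseteq> (\<Union>(a, b)\<in>V. {x. a \<bullet> x = b})"
  shows "finite (components (- X))"
proof -
  define N where "N = (\<Union>(a, b)\<in>V. {x. a \<bullet> x = b})"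
  have "negligible N"
    unfolding N_def using V by (intro negligible_Union) (auto intro: negligible_hyperplane)
  have pt: "\<exists>x. x \<in> C - N" if "C \<in> components (- X)" for C
  proof (rule ccontr)
    assume "\<not> ?thesis"
    then have "C \<subseteq> N" by blast
    with \<open>negligible N\<close> have "negligible C" by (rule negligible_subset)
    moreover have "open C" using that X(1) open_components by blast
    moreover have "C \<noteq> {}" using that in_components_nonempty by blast
    ultimately show False using open_not_negligible by blast
  qed
  define p where "p = (\<lambda>C. SOME x. x \<in> C - N)"
  have p: "p C \<in> C - N" if "C \<in> components (- X)" for C
    unfolding p_def using pt[OF that] by (rule someI_ex)
  define s where "s = (\<lambda>C. {(a, b) \<in> V. a \<bullet> p C < b})"
  have "inj_on s (components (- X))"
  proof (rule inj_onI)
    fix C D assume C: "C \<in> components (- X)" and D: "D \<in> components (- X)" and eq: "s C = s D"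
    have "\<not> a \<bullet> x = b" if x: "x \<in> closed_segment (p C) (p D)" and ab: "(a, b) \<in> V" for x a b
    proof -
      from x obtain u where u: "0 \<le> u" "u \<le> 1" "x = (1 - u) *\<^sub>R p C + u *\<^sub>R p D"
        by (auto simp: in_segment)
      have ax: "a \<bullet> x = (1 - u) * (a \<bullet> p C) + u * (a \<bullet> p D)"
        by (simp add: u inner_add_right)
      have "a \<bullet> p C \<noteq> b" "a \<bullet> p D \<noteq> b" using p[OF C] p[OF D] ab by (auto simp: N_def)
      moreover have "a \<bullet> p C < b \<longleftrightarrow> a \<bullet> p D < b" using eq ab unfolding s_def by blast
      ultimately consider "a \<bullet> p C < b" "a \<bullet> p D < b" | "a \<bullet> p C > b" "a \<bullet> p D > b" by force
      then show ?thesis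
      proof cases
        case 1
        then have "a \<bullet> x < b" unfolding ax using u convex_bound_lt[of _ b _ "1 - u" u] by simp
        then show ?thesis by simp
      next
        case 2
        then have "- (a \<bullet> x) < - b"
          unfolding ax using u convex_bound_lt[of "- (a \<bullet> p C)" "- b" "- (a \<bullet> p D)" "1 - u" u] by simp
        then show ?thesis by simp
      qed
    qed
    then have "closed_segment (p C) (p D) \<subseteq> - X" using X(2) by fastforce
    then have "closed_segment (p C) (p D) \<subseteq> C"
      using components_maximal[OF C connected_segment(1)] p[OF C] by fastforce
    then have "p D \<in> C \<inter> D" using p[OF D] by auto
    then show "C = D" using components_nonoverlap[OF C D] by blast
  qed
  moreover have "s ` components (- X) \<subseteq> Pow V" by (auto simp: s_def)
  ultimately show ?thesis using V(1) by (meson finite_Pow_iff inj_on_finite)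
qed

lemma closed_segment_subset_line:
  fixes p q :: "real \<times> real"
  assumes "p \<noteq> q"
  obtains a b where "a \<noteq> 0" "closed_segment p q \<subseteq> {x. a \<bullet> x = b}"
proof
  let ?a = "(snd q - snd p, fst p - fst q)"
  show "?a \<noteq> 0" using assms by (auto simp: prod_eq_iff)
  show "closed_segment p q \<subseteq> {x. ?a \<bullet> x = ?a \<bullet> p}"
  proof
    fix x assume "x \<in> closed_segment p q"
    then obtain u where x: "x = (1 - u) *\<^sub>R p + u *\<^sub>R q" by (auto simp: in_segment)
    have "?a \<bullet> q = ?a \<bullet> p" by (simp add: inner_prod_def algebra_simps)
    then show "x \<in> {x. ?a \<bullet> x = ?a \<bullet> p}"
      unfolding x by (simp only: inner_add_right inner_scaleR_right mem_Collect_eq) (simp add: algebra_simps)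
  qed
qed

lemma proj_linear: "linear proj"
  by (rule linearI) (auto simp: proj_def)

lemma proj_pedge:
  "proj ` pedge vs i = closed_segment (proj (vs ! i)) (proj (vs ! (Suc i mod length vs)))"
  unfolding pedge_def by (rule closed_segment_linear_image[OF proj_linear, symmetric])

lemma compact_pcurve: "compact (pcurve vs)"
  unfolding pcurve_def pedge_def by (intro compact_UN) auto

lemma compact_proj_pcurve: "compact (proj ` pcurve vs)"
  by (rule compact_continuous_image[OF continuous_on_proj compact_pcurve])

text \<open>Each edge projects into a line. Finiteness matters because \<open>card\<close> and sums
  over infinite sets are 0 by convention; it guarantees that the cost and the parities of a set of
  regions are the genuine ones.\<close>

lemma finite_regions:
  assumes "regular_proj vs"
  shows "finite (regions vs)"
proof -
  have "\<exists>a b. a \<noteq> 0 \<and> proj ` pedge vs i \<subseteq> {x. a \<bullet> x = b}" if "i < length vs" for i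
    using assms that unfolding proj_pedge regular_proj_def
    by (metis closed_segment_subset_line)
  then obtain a b where ab: "\<And>i. i < length vs \<Longrightarrow> a i \<noteq> 0"
      "\<And>i. i < length vs \<Longrightarrow> proj ` pedge vs i \<subseteq> {x. a i \<bullet> x = b i}"
    by metis
  show ?thesis
    unfolding regions_def
  proof (rule finite_components_Compl_subset_hyperplanes)
    show "finite ((\<lambda>i. (a i, b i)) ` {..<length vs})" by simp
    show "closed (proj ` pcurve vs)" by (rule compact_imp_closed[OF compact_proj_pcurve])
    show "proj ` pcurve vs \<subseteq> (\<Union>(a, b)\<in>(\<lambda>i. (a i, b i)) ` {..<length vs}. {x. a \<bullet> x = b})"
      using ab(2) unfolding pcurve_def by fastforce
  qed (use ab in auto)
qed

section \<open>Parametrised diagrams\<close>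

lemma crossings_iff:
  "q \<in> crossings vs \<longleftrightarrow> (\<exists>p1\<in>pcurve vs. \<exists>p2\<in>pcurve vs. p1 \<noteq> p2 \<and> proj p1 = q \<and> proj p2 = q)"
  by (simp add: crossings_def)

locale diagram =
  fixes vs :: "point3 list"
  assumes knot_diagram: "knot_diagram vs"
begin

text \<open>Vertices are indexed by all integers modulo \<open>n\<close>, and \<open>curve\<close>
  runs over the real line with period \<open>n\<close>. There is no base point, so an interval of
  parameters may pass over vertex 0.\<close>

definition n :: int where "n = int (length vs)"
definition vtx :: "int \<Rightarrow> point3" where "vtx i = vs ! nat (i mod n)"
definition curve :: "real \<Rightarrow> point3" where
  "curve s = vtx \<lfloor>s\<rfloor> + frac s *\<^sub>R (vtx (\<lfloor>s\<rfloor> + 1) - vtx \<lfloor>s\<rfloor>)"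
definition shadow :: "real \<Rightarrow> real \<times> real" where "shadow s = proj (curve s)"

lemma n_ge_3: "n \<ge> 3" using knot_diagram by (simp add: n_def knot_diagram_def polygonal_knot_def)

lemma vertex_index_less: "nat (i mod n) < length vs"
proof -
  have "0 \<le> i mod n" "i mod n < int (length vs)" using n_ge_3 pos_mod_sign[of n i] pos_mod_bound[of n i]
    unfolding n_def by linarith+
  then show ?thesis by (simp only: nat_less_iff)
qed

lemma Suc_vertex_index: "Suc (nat (i mod n)) mod length vs = nat ((i + 1) mod n)"
proof -
  have "0 \<le> i mod n" using n_ge_3 by simp
  then have "int (Suc (nat (i mod n)) mod length vs) = (i mod n + 1) mod n"
    by (simp add: n_def zmod_int add.commute)
  also have "\<dots> = (i + 1) mod n" by (simp add: mod_add_left_eq)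
  finally show ?thesis by simp
qed

lemma pedge_vertex_index: "pedge vs (nat (i mod n)) = closed_segment (vtx i) (vtx (i + 1))"
  by (simp add: pedge_def Suc_vertex_index vtx_def)

lemma proj_vtx_neq: "proj (vtx i) \<noteq> proj (vtx (i + 1))"
  using knot_diagram vertex_index_less[of i] Suc_vertex_index[of i]
  by (auto simp: knot_diagram_def regular_proj_def vtx_def)

text \<open>The formula also holds at the right end, where the floor has already moved to the next
  edge. This overlap yields continuity and the straight pieces on either side of a vertex.\<close>

lemma curve_on:
  assumes "of_int i \<le> s" "s \<le> of_int i + 1"
  shows "curve s = vtx i + (s - of_int i) *\<^sub>R (vtx (i + 1) - vtx i)"
proof (cases "s = of_int i + 1")
  case True
  then have "\<lfloor>s\<rfloor> = i + 1" "frac s = 0" by (auto simp: frac_def floor_eq_iff)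
  then show ?thesis using True by (simp add: curve_def)
next
  case False
  then have "\<lfloor>s\<rfloor> = i" using assms by (simp add: floor_eq_iff)
  then show ?thesis by (simp add: curve_def frac_def)
qed

lemma continuous_curve: "continuous_on S curve"
proof -
  have int: "continuous_on {of_int i..of_int i + 1} curve" for i :: int
    by (rule continuous_on_eq[of _ "\<lambda>s. vtx i + (s - of_int i) *\<^sub>R (vtx (i + 1) - vtx i)"])
       (auto intro!: continuous_intros simp: curve_on)
  have "isCont curve s" for s
  proof -
    \<comment> \<open>With the ceiling, \<open>s\<close> lies in the interior of the union of the
      two edge intervals around \<open>i\<close>, even if \<open>s\<close> is an integer.\<close>
    define i where "i = \<lceil>s\<rceil>"
    have eq: "{of_int i - 1..of_int i + 1} = {of_int i - 1..of_int i} \<union> {of_int i..of_int i + (1::real)}"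
      by auto
    have "continuous_on {of_int i - 1..of_int i + 1} curve"
      unfolding eq using int[of i] int[of "i - 1"] by (intro continuous_on_closed_Un) auto
    moreover have "s \<in> interior {of_int i - 1..of_int i + (1::real)}"
      unfolding i_def interior_atLeastAtMost_real greaterThanLessThan_iff by linarith
    ultimately show ?thesis by (rule continuous_on_interior)
  qed
  then show ?thesis by (simp add: continuous_at_imp_continuous_on)
qed

lemma continuous_shadow: "continuous_on S shadow"
  unfolding shadow_def by (rule continuous_on_compose2[OF continuous_on_proj continuous_curve]) auto

lemma curve_periodic: "curve (s + of_int k * of_int n) = curve s"
proof -
  have "\<lfloor>s + of_int k * of_int n\<rfloor> = \<lfloor>s\<rfloor> + k * n"
    by (metis floor_add_int of_int_mult)
  moreover have "frac (s + of_int k * of_int n) = frac s"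
    by (metis frac_add_of_int_right of_int_mult)
  moreover have "vtx (\<lfloor>s\<rfloor> + k * n) = vtx \<lfloor>s\<rfloor>" by (simp add: vtx_def)
  moreover have "vtx (\<lfloor>s\<rfloor> + k * n + 1) = vtx (\<lfloor>s\<rfloor> + 1)"
    unfolding vtx_def by (metis add.assoc add.commute mod_mult_self1)
  ultimately show ?thesis by (simp only: curve_def)
qed

lemma shadow_periodic: "shadow (s + of_int k * of_int n) = shadow s"
  by (simp add: shadow_def curve_periodic)

lemma curve_in_pedge: "curve s \<in> pedge vs (nat (\<lfloor>s\<rfloor> mod n))"
  unfolding pedge_vertex_index curve_def in_segment
  by (intro exI[of _ "frac s"]) (auto simp: algebra_simps frac_lt_1 less_imp_le)

lemma range_curve: "range curve = pcurve vs"
proof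
  show "range curve \<subseteq> pcurve vs" unfolding pcurve_def using curve_in_pedge vertex_index_less by blast
  show "pcurve vs \<subseteq> range curve"
  proof
    fix p assume "p \<in> pcurve vs"
    then obtain i where i: "i < length vs" "p \<in> pedge vs i" by (auto simp: pcurve_def)
    then have "nat (int i mod n) = i" by (simp add: n_def)
    with i have "p \<in> closed_segment (vtx (int i)) (vtx (int i + 1))" by (metis pedge_vertex_index)
    then obtain u where u: "0 \<le> u" "u \<le> 1" "p = (1 - u) *\<^sub>R vtx (int i) + u *\<^sub>R vtx (int i + 1)"
      by (auto simp: in_segment)
    have "p = curve (of_int (int i) + u)" using u by (subst curve_on[of "int i"]) (auto simp: algebra_simps)
    then show "p \<in> range curve" by blast
  qed
qed

lemma frac_not_top: "curve s \<noteq> vtx (\<lfloor>s\<rfloor> + 1)"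
proof
  assume "curve s = vtx (\<lfloor>s\<rfloor> + 1)"
  then have "(1 - frac s) *\<^sub>R (vtx \<lfloor>s\<rfloor> - vtx (\<lfloor>s\<rfloor> + 1)) = 0"
    by (simp add: curve_def algebra_simps)
  then have "frac s = 1" using proj_vtx_neq[of "\<lfloor>s\<rfloor>"] by auto
  then show False using frac_lt_1[of s] by simp
qed

text \<open>Two different edges share at most a vertex, which is the final point of one of them. But
  \<open>curve s\<close> never is the final point of the edge selected by the floor, so both
  parameters belong to the same edge.\<close>

lemma curve_inj:
  assumes eq: "curve s = curve t"
  shows "\<exists>k::int. t = s + of_int k * of_int n"
proof -
  define i j where "i = nat (\<lfloor>s\<rfloor> mod n)" and "j = nat (\<lfloor>t\<rfloor> mod n)"
  have both: "curve s \<in> pedge vs i \<inter> pedge vs j"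
    using curve_in_pedge[of s] curve_in_pedge[of t] eq by (simp add: i_def j_def)
  have inter: "pedge vs i \<inter> pedge vs j =
      (if j = Suc i mod length vs then {vs ! j}
       else if i = Suc j mod length vs then {vs ! i} else {})" if "i \<noteq> j"
    using knot_diagram vertex_index_less[of "\<lfloor>s\<rfloor>"] vertex_index_less[of "\<lfloor>t\<rfloor>"] that
    unfolding knot_diagram_def polygonal_knot_def i_def j_def by blast
  have "i = j"
  proof (rule ccontr)
    assume "i \<noteq> j"
    with both inter have "j = Suc i mod length vs \<and> curve s = vs ! j \<or> i = Suc j mod length vs \<and> curve t = vs ! i"
      by (auto simp: eq split: if_splits)
    then have "curve s = vtx (\<lfloor>s\<rfloor> + 1) \<or> curve t = vtx (\<lfloor>t\<rfloor> + 1)"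
      unfolding i_def j_def Suc_vertex_index vtx_def by auto
    then show False using frac_not_top by blast
  qed
  then have m: "\<lfloor>s\<rfloor> mod n = \<lfloor>t\<rfloor> mod n" using n_ge_3 by (simp add: i_def j_def eq_nat_nat_iff)
  have v: "vtx \<lfloor>s\<rfloor> = vtx \<lfloor>t\<rfloor>" "vtx (\<lfloor>s\<rfloor> + 1) = vtx (\<lfloor>t\<rfloor> + 1)"
    using m mod_add_left_eq[of "\<lfloor>s\<rfloor>" n 1] mod_add_left_eq[of "\<lfloor>t\<rfloor>" n 1] by (simp_all add: vtx_def)
  have "(frac s - frac t) *\<^sub>R (vtx (\<lfloor>t\<rfloor> + 1) - vtx \<lfloor>t\<rfloor>) = 0"
    using eq unfolding curve_def v by (simp add: algebra_simps)
  then have f: "frac s = frac t" using proj_vtx_neq[of "\<lfloor>t\<rfloor>"] by auto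
  obtain k where k: "\<lfloor>t\<rfloor> - \<lfloor>s\<rfloor> = n * k" using m by (metis mod_eq_dvd_iff dvdE)
  have "t - s = of_int (\<lfloor>t\<rfloor> - \<lfloor>s\<rfloor>)" using f by (simp add: frac_def)
  then show ?thesis unfolding k by (intro exI[of _ k]) (simp add: algebra_simps)
qed

lemma finite_crossings: "finite (crossings vs)"
  and card_fibre: "q \<in> crossings vs \<Longrightarrow> card {p \<in> pcurve vs. proj p = q} = 2"
  and vertex_not_crossing: "p \<in> pcurve vs \<Longrightarrow> proj p \<in> crossings vs \<Longrightarrow> p \<notin> set vs"
  using knot_diagram by (auto simp: knot_diagram_def regular_proj_def)

lemma range_shadow: "range shadow = proj ` pcurve vs"
  unfolding range_curve[symmetric] shadow_def by (simp add: image_image)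

lemma shadow_crossing_iff: "shadow s \<in> crossings vs \<longleftrightarrow> (\<exists>t. shadow t = shadow s \<and> curve t \<noteq> curve s)"
proof
  assume "shadow s \<in> crossings vs"
  then obtain p1 p2 where "p1 \<in> range curve" "p2 \<in> range curve" "p1 \<noteq> p2" "proj p1 = shadow s" "proj p2 = shadow s"
    unfolding crossings_iff range_curve by blast
  then show "\<exists>t. shadow t = shadow s \<and> curve t \<noteq> curve s" unfolding shadow_def by (metis imageE)
next
  assume "\<exists>t. shadow t = shadow s \<and> curve t \<noteq> curve s"
  then show "shadow s \<in> crossings vs" unfolding crossings_iff range_curve[symmetric] shadow_def by blast
qed

lemma shadow_inj: "shadow s \<notin> crossings vs \<Longrightarrow> shadow t = shadow s \<Longrightarrow> \<exists>k::int. t = s + of_int k * of_int n"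
  using shadow_crossing_iff curve_inj by metis

text \<open>At a vertex the arriving and the leaving edge may have unrelated directions, hence
  separate one-sided statements with the floor here and the ceiling minus 1 on the left.\<close>

lemma shadow_right:
  obtains d u where "0 < d" "u \<noteq> 0" "\<And>x. 0 \<le> x \<Longrightarrow> x \<le> d \<Longrightarrow> shadow (s + x) = shadow s + x *\<^sub>R u"
proof
  define i where "i = \<lfloor>s\<rfloor>"
  define u where "u = proj (vtx (i + 1)) - proj (vtx i)"
  show "0 < of_int i + 1 - s" unfolding i_def by linarith
  show "u \<noteq> 0" using proj_vtx_neq[of i] by (simp add: u_def)
  fix x assume "0 \<le> x" "x \<le> of_int i + 1 - s"
  moreover have "of_int i \<le> s" "s \<le> of_int i + 1" unfolding i_def by linarith+
  ultimately show "shadow (s + x) = shadow s + x *\<^sub>R u"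
    by (simp add: shadow_def curve_on[of i] u_def linear_add[OF proj_linear] linear_diff[OF proj_linear]
        linear_cmul[OF proj_linear] algebra_simps)
qed

lemma shadow_left:
  obtains d u where "0 < d" "u \<noteq> 0" "\<And>x. 0 \<le> x \<Longrightarrow> x \<le> d \<Longrightarrow> shadow (s - x) = shadow s + x *\<^sub>R u"
proof
  define i where "i = \<lceil>s\<rceil> - 1"
  define u where "u = proj (vtx i) - proj (vtx (i + 1))"
  show "0 < s - of_int i" unfolding i_def by linarith
  show "u \<noteq> 0" using proj_vtx_neq[of i] by (simp add: u_def)
  fix x assume "0 \<le> x" "x \<le> s - of_int i"
  moreover have "of_int i \<le> s" "s \<le> of_int i + 1" unfolding i_def by linarith+
  ultimately show "shadow (s - x) = shadow s + x *\<^sub>R u"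
    by (simp add: shadow_def curve_on[of i] u_def linear_add[OF proj_linear] linear_diff[OF proj_linear]
        linear_cmul[OF proj_linear] algebra_simps)
qed

text \<open>Preimages of crossings are not vertices, so the parameter is interior to an edge and the
  direction is the same on both sides.\<close>

lemma shadow_straight_at_crossing:
  assumes "shadow s \<in> crossings vs"
  obtains d u where "0 < d" "u \<noteq> 0" "\<And>x. \<bar>x\<bar> \<le> d \<Longrightarrow> shadow (s + x) = shadow s + x *\<^sub>R u"
proof
  define i where "i = \<lfloor>s\<rfloor>"
  define u where "u = proj (vtx (i + 1)) - proj (vtx i)"
  have "s \<noteq> of_int i"
  proof
    assume "s = of_int i"
    then have "curve s = vs ! nat (i mod n)" by (subst curve_on[of i]) (auto simp: vtx_def)
    then have "curve s \<in> set vs" using vertex_index_less by simp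
    then show False using vertex_not_crossing[of "curve s"] assms range_curve by (auto simp: shadow_def)
  qed
  moreover have i: "of_int i \<le> s" "s < of_int i + 1" unfolding i_def by linarith+
  ultimately show "0 < min (s - of_int i) (of_int i + 1 - s)" by simp
  show "u \<noteq> 0" using proj_vtx_neq[of i] by (simp add: u_def)
  fix x assume "\<bar>x\<bar> \<le> min (s - of_int i) (of_int i + 1 - s)"
  then have "of_int i \<le> s + x" "s + x \<le> of_int i + 1" by linarith+
  then show "shadow (s + x) = shadow s + x *\<^sub>R u" using i
    by (simp add: shadow_def curve_on[of i] u_def linear_add[OF proj_linear] linear_diff[OF proj_linear]
        linear_cmul[OF proj_linear] algebra_simps)
qed

end

section \<open>Following the frontier of a region along the curve\<close>

context diagram begin

lemma closed_range_shadow: "closed (range shadow)"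
  unfolding range_shadow by (rule compact_imp_closed[OF compact_proj_pcurve])

lemma regions_components: "regions vs = components (- range shadow)"
  by (simp add: regions_def range_shadow)

lemma n_pos: "0 < real_of_int n" using n_ge_3 by simp

lemma frontier_right_limit:
  assumes R: "R \<in> regions vs" and s: "shadow s \<in> frontier R" "shadow s \<notin> crossings vs" and d: "0 < d"
  shows "\<exists>t. s < t \<and> t < s + d \<and> shadow t \<in> frontier R"
proof -
  obtain d' u where u: "0 < d'" "u \<noteq> 0" "\<And>x. 0 \<le> x \<Longrightarrow> x \<le> d' \<Longrightarrow> shadow (s - x) = shadow s + x *\<^sub>R u"
    using shadow_left[of s] by blast
  show ?thesis
    by (rule frontier_param_right_limit[OF continuous_shadow n_pos shadow_periodic shadow_inj[OF s(2)] u(1,2,3)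
        R[unfolded regions_components] closed_range_shadow s(1) d])
qed

lemma frontier_left_limit:
  assumes R: "R \<in> regions vs" and s: "shadow s \<in> frontier R" "shadow s \<notin> crossings vs" and d: "0 < d"
  shows "\<exists>t. s - d < t \<and> t < s \<and> shadow t \<in> frontier R"
proof -
  obtain d' u where u: "0 < d'" "u \<noteq> 0" "\<And>x. 0 \<le> x \<Longrightarrow> x \<le> d' \<Longrightarrow> shadow (s + x) = shadow s + x *\<^sub>R u"
    using shadow_right[of s] by blast
  \<comment> \<open>Reversing the orientation of the curve reduces limits from the left to limits
    from the right.\<close>
  have range: "range (\<lambda>t. shadow (- t)) = range shadow"
    using image_image[of shadow uminus UNIV] surj_uminus by simp
  have "\<exists>t>- s. t < - s + d \<and> shadow (- t) \<in> frontier R"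
  proof (rule frontier_param_right_limit[of "\<lambda>t. shadow (- t)" "of_int n" "- s" d' u R d])
    show "continuous_on UNIV (\<lambda>t. shadow (- t))"
      by (rule continuous_on_compose2[OF continuous_shadow]) (auto intro: continuous_intros)
    show "shadow (- (t + of_int k * of_int n)) = shadow (- t)" for t k
      using shadow_periodic[of "- t" "- k"] by (simp add: algebra_simps)
    show "\<exists>k::int. t = - s + of_int k * of_int n" if t: "shadow (- t) = shadow (- (- s))" for t
    proof -
      obtain k :: int where "- t = s + of_int k * of_int n" using shadow_inj[OF s(2), of "- t"] t by auto
      then show ?thesis by (intro exI[of _ "- k"]) auto
    qed
  qed (use n_pos u s d R regions_components range closed_range_shadow in \<open>auto simp: add.commute\<close>)
  then obtain t where "t > - s" "t < - s + d" "shadow (- t) \<in> frontier R" by blast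
  then show ?thesis by (intro exI[of _ "- t"]) auto
qed

text \<open>A finite set does not separate the plane. A region with finite frontier would be all of
  the complement of that frontier, leaving only finitely many points for the shadow, which contains
  a segment. This supplies a frontier point from which an edge can be followed.\<close>

lemma frontier_not_subset_crossings:
  assumes R: "R \<in> regions vs"
  shows "\<not> frontier R \<subseteq> crossings vs"
proof
  assume sub: "frontier R \<subseteq> crossings vs"
  then have fin: "finite (frontier R)" using finite_crossings finite_subset by blast
  have "R \<noteq> {}" "R \<inter> range shadow = {}"
    using R in_components_nonempty in_components_subset unfolding regions_components by blast+
  have "connected (- frontier R)"
    using path_connected_complement_countable[OF _ countable_finite[OF fin]]
    by (simp add: path_connected_imp_connected)
  moreover have "open R" using R closed_range_shadow open_components unfolding regions_components by blast
  then have "R \<subseteq> - frontier R" by (auto simp: frontier_def interior_open)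
  ultimately have "- frontier R \<subseteq> R"
    using connected_Int_frontier[of "- frontier R" R] \<open>R \<noteq> {}\<close> by blast
  then have "finite (range shadow)" using \<open>R \<inter> range shadow = {}\<close> by (intro finite_subset[OF _ fin]) auto
  moreover obtain d u where u: "0 < d" "u \<noteq> 0" "\<And>x. 0 \<le> x \<Longrightarrow> x \<le> d \<Longrightarrow> shadow (0 + x) = shadow 0 + x *\<^sub>R u"
    using shadow_right[of 0] by blast
  have "inj_on shadow {0..d}"
  proof (rule inj_onI)
    fix x y assume "x \<in> {0..d}" "y \<in> {0..d}" "shadow x = shadow y"
    then have "x *\<^sub>R u = y *\<^sub>R u" using u(3)[of x] u(3)[of y] by simp
    then show "x = y" using u(2) by simp
  qed
  then have "infinite (shadow ` {0..d})" using u(1) by (simp add: finite_image_iff)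
  ultimately show False by (meson finite_subset image_mono subset_UNIV)
qed

definition crossing_params :: "real set" where "crossing_params = {t. shadow t \<in> crossings vs}"

lemma closed_crossing_params: "closed crossing_params"
  using closed_vimage[OF finite_imp_closed[OF finite_crossings] continuous_shadow]
  by (simp add: crossing_params_def vimage_def)

lemma crossing_params_shift: "t + of_int k * of_int n \<in> crossing_params \<longleftrightarrow> t \<in> crossing_params"
  by (simp add: crossing_params_def shadow_periodic)

lemma crossing_loop:
  assumes R: "R \<in> regions vs" and q: "{x \<in> crossings vs. x \<in> frontier R} = {q}"
  obtains b e where "b < e" "e < b + of_int n" "shadow b = q" "shadow e = q"
    "\<And>t. b < t \<Longrightarrow> t < e \<Longrightarrow> shadow t \<notin> crossings vs"
proof -
  define T where "T = {t. shadow t \<in> frontier R}"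
  have T: "closed T"
    using closed_vimage[OF frontier_closed continuous_shadow, of R] by (simp add: T_def vimage_def)
  have fR: "frontier R \<subseteq> range shadow"
    using frontier_of_components_closed_complement[OF closed_range_shadow] R regions_components by blast
  obtain s where s: "s \<in> T" "s \<notin> crossing_params"
    using frontier_not_subset_crossings[OF R] fR unfolding T_def crossing_params_def mem_Collect_eq subset_iff
    by blast
  have "q \<in> range shadow" using q fR by auto
  then obtain t0 where t0: "t0 \<in> crossing_params" using q by (auto simp: crossing_params_def)
  let ?U = "crossing_params \<inter> {s..}" and ?L = "crossing_params \<inter> {..s}"
  obtain k1 :: int where "s \<le> t0 + of_int k1 * of_int n" by (rule ex_shift_in_interval[OF n_pos])
  then have U: "?U \<noteq> {}" "bdd_below ?U" using crossing_params_shift[of t0 k1] t0 by auto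
  obtain k2 :: int where "t0 + of_int k2 * of_int n < (s - of_int n) + of_int n"
    by (rule ex_shift_in_interval[OF n_pos])
  then have L: "?L \<noteq> {}" "bdd_above ?L" using crossing_params_shift[of t0 k2] t0 by (auto intro!: less_imp_le)
  \<comment> \<open>The nearest crossing parameters on the two sides of \<open>s\<close>; both exist
    by periodicity and because the set of crossing parameters is closed.\<close>
  define e where "e = Inf ?U"
  define b where "b = Sup ?L"
  have e: "e \<in> ?U" unfolding e_def using U closed_crossing_params by (intro closed_contains_Inf) auto
  have b: "b \<in> ?L" unfolding b_def using L closed_crossing_params by (intro closed_contains_Sup) auto
  have bs: "b < s" and se: "s < e" using b e s(2) by (auto simp: order.strict_iff_order)
  have no_param: "t \<notin> crossing_params" if "b < t" "t < e" for t
  proof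
    assume "t \<in> crossing_params"
    show False
    proof (cases "s \<le> t")
      case True
      with \<open>t \<in> crossing_params\<close> have "e \<le> t" unfolding e_def by (intro cInf_lower U) auto
      with that show False by simp
    next
      case False
      with \<open>t \<in> crossing_params\<close> have "t \<le> b" unfolding b_def by (intro cSup_upper L) auto
      with that show False by simp
    qed
  qed
  have "e \<in> T"
  proof (rule closed_right_limits_reach[OF T s(1) se])
    fix m assume m: "m \<in> T" "s \<le> m" "m < e"
    then have "shadow m \<in> frontier R" "shadow m \<notin> crossings vs" "0 < e - m"
      using no_param[of m] bs by (auto simp: T_def crossing_params_def)
    from frontier_right_limit[OF R this] show "\<exists>t\<in>T. m < t \<and> t < e" by (auto simp: T_def)
  qed
  then have aq_e: "shadow e = q" using e q by (auto simp: T_def crossing_params_def)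
  have "b \<in> T"
  proof (rule closed_left_limits_reach[OF T s(1) bs])
    fix m assume m: "m \<in> T" "m \<le> s" "b < m"
    then have "shadow m \<in> frontier R" "shadow m \<notin> crossings vs" "0 < m - b"
      using no_param[of m] se by (auto simp: T_def crossing_params_def)
    from frontier_left_limit[OF R this] show "\<exists>t\<in>T. b < t \<and> t < m" by (auto simp: T_def)
  qed
  then have aq_b: "shadow b = q" using b q by (auto simp: T_def crossing_params_def)
  have "b + of_int n \<in> crossing_params" using crossing_params_shift[of b 1] b by simp
  then have le: "e \<le> b + of_int n" using no_param[of "b + of_int n"] n_pos by fastforce
  \<comment> \<open>The second strand through \<open>q\<close> has a parameter in each period; if
    the edge took up a whole period, that parameter would lie strictly between \<open>b\<close> and
    \<open>e\<close>.\<close>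
  have "e \<noteq> b + of_int n"
  proof
    assume eq: "e = b + of_int n"
    obtain t where t: "shadow t = shadow b" "curve t \<noteq> curve b" using b shadow_crossing_iff by (auto simp: crossing_params_def)
    obtain k :: int where k: "b \<le> t + of_int k * of_int n" "t + of_int k * of_int n < b + of_int n"
      by (rule ex_shift_in_interval[OF n_pos])
    have "t + of_int k * of_int n \<in> crossing_params" using t(1) b by (simp add: crossing_params_def shadow_periodic)
    then have "t + of_int k * of_int n = b" using no_param[of "t + of_int k * of_int n"] k eq by fastforce
    then show False using t(2) curve_periodic by metis
  qed
  with le have "e < b + of_int n" by simp
  moreover have "b < e" using bs se by simp
  ultimately show thesis using that aq_b aq_e no_param by (simp add: crossing_params_def)
qed

end

section \<open>Changing a nugatory crossing\<close>

definition cpx :: "real \<times> real \<Rightarrow> complex" where "cpx p = Complex (fst p) (snd p)"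

lemma cpx_add_scaleR: "cpx (p + x *\<^sub>R u) = cpx p + of_real x * cpx u"
  by (simp add: cpx_def complex_eq_iff)

lemma cpx_eq_iff: "cpx p = cpx q \<longleftrightarrow> p = q"
  by (simp add: cpx_def prod_eq_iff)

lemma unit_interval_images:
  fixes x y :: real
  assumes "x < y"
  shows "(\<lambda>z. x + z * (y - x)) ` {0..1} = {x..y}" "(\<lambda>z. y - z * (y - x)) ` {0..1} = {x..y}"
proof -
  have eq: "(\<lambda>z. x + z * (y - x)) = (\<lambda>z. (y - x) * z + x)" "(\<lambda>z. y - z * (y - x)) = (\<lambda>z. (x - y) * z + y)"
    by (auto simp: algebra_simps)
  show "(\<lambda>z. x + z * (y - x)) ` {0..1} = {x..y}" "(\<lambda>z. y - z * (y - x)) ` {0..1} = {x..y}"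
    unfolding eq image_affinity_atLeastAtMost using assms by auto
qed

lemma continuous_on_cpx: "continuous_on S f \<Longrightarrow> continuous_on S (\<lambda>x. cpx (f x))"
  unfolding cpx_def Complex_eq by (intro continuous_intros)

context diagram begin

lemma pcurve_eq_image: "pcurve vs = curve ` {A..<A + of_int n}" "pcurve vs = curve ` {A..A + of_int n}"
proof -
  have "\<exists>s\<in>{A..<A + of_int n}. p = curve s" if p: "p \<in> pcurve vs" for p
  proof -
    obtain t where "p = curve t" using p unfolding range_curve[symmetric] by blast
    moreover obtain k :: int where "A \<le> t + of_int k * of_int n" "t + of_int k * of_int n < A + of_int n"
      by (rule ex_shift_in_interval[OF n_pos])
    ultimately show ?thesis
      by (intro bexI[of _ "t + of_int k * of_int n"]) (auto simp: curve_periodic)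
  qed
  then have "pcurve vs \<subseteq> curve ` {A..<A + of_int n}" by blast
  moreover have "curve ` {A..<A + of_int n} \<subseteq> curve ` {A..A + of_int n}" by (intro image_mono) auto
  moreover have "curve ` S \<subseteq> pcurve vs" for S unfolding range_curve[symmetric] by blast
  ultimately show "pcurve vs = curve ` {A..<A + of_int n}" "pcurve vs = curve ` {A..A + of_int n}"
    by blast+
qed

lemma curve_inj_short: "curve s = curve t \<Longrightarrow> \<bar>s - t\<bar> < of_int n \<Longrightarrow> s = t"
proof -
  assume "curve s = curve t" and lt: "\<bar>s - t\<bar> < of_int n"
  then obtain k :: int where k: "t = s + of_int k * of_int n" using curve_inj by blast
  then have "\<bar>real_of_int k\<bar> * of_int n < 1 * of_int n"
    using lt n_pos by (simp add: abs_mult)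
  then have "\<bar>real_of_int k\<bar> < 1" unfolding mult_less_cancel_right_pos[OF n_pos] .
  then have "k = 0" by linarith
  then show ?thesis using k by simp
qed

text \<open>The straight shadow leaves its own crossing at once, and the finitely many other
  crossings are at a positive distance.\<close>

lemma crossing_params_isolated:
  assumes "s \<in> crossing_params"
  obtains d where "0 < d" "\<And>x. 0 < \<bar>x\<bar> \<Longrightarrow> \<bar>x\<bar> \<le> d \<Longrightarrow> s + x \<notin> crossing_params"
proof -
  obtain d u where u: "0 < d" "u \<noteq> 0" "\<And>x. \<bar>x\<bar> \<le> d \<Longrightarrow> shadow (s + x) = shadow s + x *\<^sub>R u"
    using shadow_straight_at_crossing[of s] assms unfolding crossing_params_def by blast
  have "open (- (crossings vs - {shadow s}))"
    using finite_crossings by (intro open_Compl finite_imp_closed) auto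
  then obtain r where r: "0 < r" "ball (shadow s) r \<subseteq> - (crossings vs - {shadow s})"
    using openE[of "- (crossings vs - {shadow s})" "shadow s"] by blast
  show thesis
  proof
    \<comment> \<open>Within this bound the straight piece moves by at most \<open>r / 2\<close> and
      stays in the ball.\<close>
    show "0 < min d (r / (2 * norm u))" using u r by simp
    fix x :: real assume x: "0 < \<bar>x\<bar>" "\<bar>x\<bar> \<le> min d (r / (2 * norm u))"
    then have eq: "shadow (s + x) = shadow s + x *\<^sub>R u" using u(3) by simp
    have "\<bar>x\<bar> * norm u \<le> r / 2" using x(2) u(2) by (simp add: field_simps)
    then have "shadow (s + x) \<in> ball (shadow s) r" using r(1) by (simp add: eq dist_norm)
    moreover have "shadow (s + x) \<noteq> shadow s" using x(1) u(2) by (simp add: eq)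
    ultimately show "s + x \<notin> crossing_params" using r(2) by (auto simp: crossing_params_def)
  qed
qed

text \<open>The margin is twice \<epsilon>: one \<epsilon> for the collar that becomes part of the
  cap, and one for the stretch on which the height of the remaining knot is brought back from
  0.\<close>

lemma loop_collar:
  assumes "b < e" "e < b + of_int n" "b \<in> crossing_params" "e \<in> crossing_params"
  obtains \<epsilon> where "0 < \<epsilon>" "e + \<epsilon> < b - \<epsilon> + of_int n"
    "\<And>t. b - 2 * \<epsilon> \<le> t \<Longrightarrow> t < b \<Longrightarrow> t \<notin> crossing_params" "\<And>t. e < t \<Longrightarrow> t \<le> e + 2 * \<epsilon> \<Longrightarrow> t \<notin> crossing_params"
proof -
  obtain d where d: "0 < d" "\<And>x. 0 < \<bar>x\<bar> \<Longrightarrow> \<bar>x\<bar> \<le> d \<Longrightarrow> b + x \<notin> crossing_params"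
    using crossing_params_isolated[OF assms(3)] by blast
  obtain d' where d': "0 < d'" "\<And>x. 0 < \<bar>x\<bar> \<Longrightarrow> \<bar>x\<bar> \<le> d' \<Longrightarrow> e + x \<notin> crossing_params"
    using crossing_params_isolated[OF assms(4)] by blast
  define \<epsilon> where "\<epsilon> = Min {d / 2, d' / 2, (b + of_int n - e) / 4}"
  have \<epsilon>: "0 < \<epsilon>" "\<epsilon> \<le> d / 2" "\<epsilon> \<le> d' / 2" "\<epsilon> \<le> (b + of_int n - e) / 4"
    unfolding \<epsilon>_def using d(1) d'(1) assms(2) by (simp, (intro Min_le; simp)+)
  show thesis
  proof
    show "0 < \<epsilon>" by (rule \<epsilon>(1))
    have "4 * \<epsilon> \<le> b + of_int n - e" using \<epsilon>(4) by simp
    then show "e + \<epsilon> < b - \<epsilon> + of_int n" using \<epsilon>(1) by linarith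
    show "t \<notin> crossing_params" if "b - 2 * \<epsilon> \<le> t" "t < b" for t
      using d(2)[of "t - b"] \<epsilon> that by simp
    show "t \<notin> crossing_params" if "e < t" "t \<le> e + 2 * \<epsilon>" for t
      using d'(2)[of "t - e"] \<epsilon> that by simp
  qed
qed

end

text \<open>The bound \<open>M\<close> serves to lower the given height \<open>h0\<close>, so that
  everything outside the cap lies at height at most 0.\<close>

locale loop_diagram = diagram +
  fixes b e \<epsilon> :: real and q and h0 :: "point3 \<Rightarrow> real" and M :: real
  assumes be: "b < e" and q: "shadow b = q" "shadow e = q" "q \<in> crossings vs"
    and no_crossing: "\<And>t. b < t \<Longrightarrow> t < e \<Longrightarrow> t \<notin> crossing_params"
    and \<epsilon>: "0 < \<epsilon>" "e + \<epsilon> < b - \<epsilon> + of_int n"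
    and no_left: "\<And>t. b - 2 * \<epsilon> \<le> t \<Longrightarrow> t < b \<Longrightarrow> t \<notin> crossing_params"
    and no_right: "\<And>t. e < t \<Longrightarrow> t \<le> e + 2 * \<epsilon> \<Longrightarrow> t \<notin> crossing_params"
    and h0: "continuous_on (pcurve vs) h0" and M: "\<And>p. p \<in> pcurve vs \<Longrightarrow> h0 p \<le> M"
begin

text \<open>The factor \<open>min 1 \<dots>\<close> in \<open>rest\<close> equals 1 at every crossing, so that \<open>rest\<close> keeps the order of
  \<open>h0\<close> there. The height \<open>H m\<close> has its peak at the parameter \<open>m\<close>, which will be \<open>b\<close> or \<open>e\<close>.\<close>

definition A where "A = b - \<epsilon>"
definition B where "B = e + \<epsilon>"
definition rest :: "real \<Rightarrow> real" where
  "rest s = (h0 (curve s) - M) * min 1 (min ((s - B) / \<epsilon>) ((A + of_int n - s) / \<epsilon>))"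
definition H :: "real \<Rightarrow> real \<Rightarrow> real" where
  "H m s = (if s \<le> m then (s - A) / (m - A) else if s \<le> B then (B - s) / (B - m) else rest s)"

lemma AB: "A < b" "b < e" "e < B" "B < A + of_int n"
  using be \<epsilon> by (auto simp: A_def B_def)

lemma crossing_params_in_AB: "t \<in> crossing_params \<Longrightarrow> A \<le> t \<Longrightarrow> t \<le> B \<Longrightarrow> t = b \<or> t = e"
proof -
  assume t: "t \<in> crossing_params" "A \<le> t" "t \<le> B"
  have "\<not> t < b" using no_left[of t] t \<epsilon>(1) by (auto simp: A_def)
  moreover have "\<not> e < t" using no_right[of t] t \<epsilon>(1) by (auto simp: B_def)
  moreover have "\<not> (b < t \<and> t < e)" using no_crossing[of t] t by auto
  ultimately show ?thesis by linarith
qed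

lemma continuous_rest: "continuous_on S rest"
proof -
  have "continuous_on S (\<lambda>s. h0 (curve s))"
    by (rule continuous_on_compose2[OF h0 continuous_curve]) (auto simp flip: range_curve)
  then show ?thesis unfolding rest_def using \<epsilon>(1) by (auto intro!: continuous_intros)
qed

lemma rest_ends: "rest B = 0" "rest (A + of_int n) = 0"
proof -
  have "0 \<le> (A + of_int n - B) / \<epsilon>" using \<epsilon>(1) AB by (intro divide_nonneg_pos) auto
  then show "rest B = 0" "rest (A + of_int n) = 0" using \<epsilon>(1) AB by (auto simp: rest_def)
qed

lemma rest_nonpos:
  assumes "B \<le> s" "s \<le> A + of_int n"
  shows "rest s \<le> 0"
proof -
  have "h0 (curve s) - M \<le> 0" using M[of "curve s"] range_curve by auto
  moreover have "0 \<le> min 1 (min ((s - B) / \<epsilon>) ((A + of_int n - s) / \<epsilon>))"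
    using assms \<epsilon>(1) by auto
  ultimately show ?thesis unfolding rest_def by (rule mult_nonpos_nonneg)
qed

text \<open>Beyond \<open>B\<close> there is no crossing before \<open>e + 2 * \<epsilon>\<close>,
  that is \<open>B + \<epsilon>\<close>, where the first ramp has reached 1; the other ramp is
  treated by translation through one period.\<close>

lemma rest_crossing:
  assumes "s \<in> crossing_params" "B < s" "s < A + of_int n"
  shows "rest s = h0 (curve s) - M"
proof -
  have "e + 2 * \<epsilon> < s" using no_right[of s] assms AB by fastforce
  moreover have "s - of_int n \<in> crossing_params" using crossing_params_shift[of s "-1"] assms(1) by simp
  then have "s - of_int n < b - 2 * \<epsilon>" using no_left[of "s - of_int n"] assms AB by fastforce
  ultimately have "(s - B) / \<epsilon> \<ge> 1" "(A + of_int n - s) / \<epsilon> \<ge> 1"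
    using \<epsilon>(1) by (auto simp: A_def B_def field_simps)
  then show ?thesis by (simp add: rest_def)
qed

lemma curve_be: "curve b \<noteq> curve e"
  using curve_inj_short[of b e] AB by auto

lemma fibre_q: "{p \<in> pcurve vs. proj p = q} = {curve b, curve e}"
proof -
  have "{curve b, curve e} \<subseteq> {p \<in> pcurve vs. proj p = q}" using q range_curve by (auto simp: shadow_def)
  moreover have "card {curve b, curve e} = card {p \<in> pcurve vs. proj p = q}"
    using curve_be card_fibre[OF q(3)] by simp
  moreover have "finite {p \<in> pcurve vs. proj p = q}"
    using card_fibre[OF q(3)] by (intro card_ge_0_finite) simp
  ultimately show ?thesis using card_subset_eq by blast
qed

lemma continuous_H:
  assumes m: "m = b \<or> m = e"
  shows "continuous_on {A..A + of_int n} (H m)"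
proof -
  have mAB: "A < m" "m < B" using m AB by auto
  have 1: "continuous_on {A..A + of_int n} (\<lambda>s. if s \<le> B then (B - s) / (B - m) else rest s)"
    by (rule continuous_on_cases_le)
       (use mAB rest_ends continuous_rest in \<open>auto intro!: continuous_intros\<close>)
  have 2: "continuous_on {s \<in> {A..A + of_int n}. m \<le> s}
      (\<lambda>s. if s \<le> B then (B - s) / (B - m) else rest s)"
    by (rule continuous_on_subset[OF 1]) auto
  have 3: "continuous_on {s \<in> {A..A + of_int n}. s \<le> m} (\<lambda>s. (s - A) / (m - A))"
    using mAB by (intro continuous_intros) auto
  have "continuous_on {A..A + of_int n} (\<lambda>s. if s \<le> m then (s - A) / (m - A)
      else if s \<le> B then (B - s) / (B - m) else rest s)"
    by (rule continuous_on_cases_le[OF 3 2 continuous_on_id]) (use mAB in auto)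
  then show ?thesis by (simp add: H_def)
qed

text \<open>On a closed period only the two ends give the same point of the knot, and
  \<open>H m\<close> is 0 at both, so it descends to the knot.\<close>

lemma ex_height:
  assumes m: "m = b \<or> m = e"
  obtains h where "continuous_on (pcurve vs) h" "\<forall>s\<in>{A..A + of_int n}. h (curve s) = H m s"
proof -
  have ends: "H m A = H m (A + of_int n)"
    using m AB by (auto simp: H_def rest_ends)
  have eq: "H m s = H m t"
    if st: "s \<in> {A..A + of_int n}" "t \<in> {A..A + of_int n}" "curve s = curve t" for s t
  proof -
    have "s = t \<or> \<bar>s - t\<bar> = of_int n" using curve_inj_short[OF st(3)] st(1,2) by fastforce
    then have "s = t \<or> s = A \<and> t = A + of_int n \<or> t = A \<and> s = A + of_int n"
      using st(1,2) by auto
    then show ?thesis using ends by auto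
  qed
  obtain h where "continuous_on (curve ` {A..A + of_int n}) h"
      "\<And>s. s \<in> {A..A + of_int n} \<Longrightarrow> h (curve s) = H m s"
    using continuous_on_factor_compact[OF compact_Icc continuous_curve continuous_H[OF m] eq] by blast
  then show thesis using that pcurve_eq_image(2)[of A] by simp
qed

text \<open>Away from \<open>q\<close> the new height is \<open>h0\<close> lowered by
  \<open>M\<close>, so the order survives. At \<open>q\<close> the strand at \<open>m\<close> has
  height 1 and the other one less, so the choice of \<open>m\<close> alone decides the
  crossing.\<close>

lemma height_at_crossings:
  assumes m: "m = b \<or> m = e"
    and h: "\<forall>s\<in>{A..A + of_int n}. h (curve s) = H m s"
  shows "p1 \<in> pcurve vs \<Longrightarrow> p2 \<in> pcurve vs \<Longrightarrow> p1 \<noteq> p2 \<Longrightarrow> proj p1 = proj p2 \<Longrightarrow> proj p1 \<noteq> q \<Longrightarrow>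
      h p1 - h p2 = h0 p1 - h0 p2"
    and "h (curve b) < h (curve e) \<longleftrightarrow> m = e" and "h (curve e) < h (curve b) \<longleftrightarrow> m = b"
proof -
  have *: "h p = h0 p - M" if p: "p \<in> pcurve vs" "proj p \<in> crossings vs" "proj p \<noteq> q" for p
  proof -
    obtain s where s: "A \<le> s" "s < A + of_int n" "p = curve s"
      using p(1) pcurve_eq_image(1)[of A] by auto
    have "s \<in> crossing_params" using p(2) by (simp add: crossing_params_def shadow_def s)
    moreover have "s \<noteq> b" "s \<noteq> e" using p(3) q by (auto simp: s shadow_def)
    ultimately have "B < s" using crossing_params_in_AB[of s] s by force
    then have "h p = rest s" using bspec[OF h, of s] s m AB by (auto simp: H_def)
    then show ?thesis using rest_crossing[OF \<open>s \<in> crossing_params\<close> \<open>B < s\<close>] s by simp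
  qed
  show "h p1 - h p2 = h0 p1 - h0 p2" if "p1 \<in> pcurve vs" "p2 \<in> pcurve vs" "p1 \<noteq> p2"
    "proj p1 = proj p2" "proj p1 \<noteq> q"
  proof -
    have "proj p1 \<in> crossings vs" using that unfolding crossings_iff by metis
    then show ?thesis using *[of p1] *[of p2] that by simp
  qed
  have less: "(b - A) / (e - A) < 1" "(B - e) / (B - b) < 1" using AB by auto
  have hb: "h (curve b) = H m b" "h (curve e) = H m e" using h AB by auto
  show "h (curve b) < h (curve e) \<longleftrightarrow> m = e" "h (curve e) < h (curve b) \<longleftrightarrow> m = b"
    unfolding hb H_def using m AB less by auto
qed

text \<open>The point is that the target mentions neither \<open>m\<close> nor \<open>h\<close>, so
  the lifts for both choices of \<open>m\<close> are isotopic to the same set. The position of its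
  apex over the origin of the plane is arbitrary, since all else is at height at most 0.\<close>

lemma lift_isotopic_cap:
  assumes m: "m = b \<or> m = e"
    and h: "\<forall>s\<in>{A..A + of_int n}. h (curve s) = H m s"
  shows "ambient_isotopic (lift h ` pcurve vs)
    ((\<lambda>s. spatial (cpx (shadow s)) (rest s)) ` {B..A + of_int n} \<union>
      (\<lambda>z. spatial (of_real (1 - z) * cpx (shadow A)) z) ` {0..1} \<union>
      (\<lambda>z. spatial (of_real (1 - z) * cpx (shadow B)) z) ` {0..1})"
proof -
  have mAB: "A < m" "m < B" using m AB by auto
  \<comment> \<open>The two strands from the ends of the collar up to the peak, reparametrised by
    their height.\<close>
  define p1 where "p1 = (\<lambda>z. cpx (shadow (A + z * (m - A))))"
  define p2 where "p2 = (\<lambda>z. cpx (shadow (B - z * (B - m))))"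
  let ?R = "(\<lambda>s. spatial (cpx (shadow s)) (rest s)) ` {B..A + of_int n}"
  have lift_curve: "lift h (curve s) = spatial (cpx (shadow s)) (H m s)" if "A \<le> s" "s \<le> A + of_int n" for s
    using bspec[OF h, of s] that by (simp add: lift_def spatial_def cpx_def shadow_def proj_def)
  have "{A..A + of_int n} = {B..A + of_int n} \<union> {A..m} \<union> {m..B}" using AB mAB by auto
  then have "lift h ` pcurve vs =
      (\<lambda>s. lift h (curve s)) ` {B..A + of_int n} \<union> (\<lambda>s. lift h (curve s)) ` {A..m} \<union> (\<lambda>s. lift h (curve s)) ` {m..B}"
    unfolding pcurve_eq_image(2)[of A] by (simp only: image_Un image_image)
  also have "(\<lambda>s. lift h (curve s)) ` {B..A + of_int n} = ?R"
  proof (rule image_cong[OF refl])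
    fix s assume "s \<in> {B..A + of_int n}"
    then show "lift h (curve s) = spatial (cpx (shadow s)) (rest s)"
      using lift_curve[of s] mAB AB rest_ends by (cases "s = B") (auto simp: H_def)
  qed
  also have "(\<lambda>s. lift h (curve s)) ` {A..m} = (\<lambda>z. spatial (p1 z) z) ` {0..1}"
  proof -
    have "{A..m} = (\<lambda>z. A + z * (m - A)) ` {0..1}" using unit_interval_images(1)[OF mAB(1)] by simp
    moreover have "lift h (curve (A + z * (m - A))) = spatial (p1 z) z" if "z \<in> {0..1}" for z
    proof -
      have "z * (m - A) \<le> m - A" "0 \<le> z * (m - A)"
        using that mAB by (auto intro: mult_left_le_one_le)
      then have s: "A \<le> A + z * (m - A)" "A + z * (m - A) \<le> m" by linarith+
      then have "H m (A + z * (m - A)) = z" using mAB by (simp add: H_def)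
      moreover have "A + z * (m - A) \<le> A + of_int n" using s mAB AB by linarith
      ultimately show ?thesis using lift_curve[OF s(1)] by (simp add: p1_def)
    qed
    ultimately show ?thesis by (simp add: image_image)
  qed
  also have "(\<lambda>s. lift h (curve s)) ` {m..B} = (\<lambda>z. spatial (p2 z) z) ` {0..1}"
  proof -
    have "{m..B} = (\<lambda>z. B - z * (B - m)) ` {0..1}" using unit_interval_images(2)[OF mAB(2)] by simp
    moreover have "lift h (curve (B - z * (B - m))) = spatial (p2 z) z" if z: "z \<in> {0..1}" for z
    proof -
      have *: "z * (B - m) \<le> B - m" "0 \<le> z * (B - m)"
        using z mAB by (auto intro: mult_left_le_one_le)
      have "H m (B - z * (B - m)) = z"
      \<comment> \<open>At the peak the parameter is \<open>m\<close>, which the definition of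
        \<open>H\<close> assigns to the ascending branch.\<close>
      proof (cases "z = 1")
        case True
        then show ?thesis using mAB by (simp add: H_def)
      next
        case False
        then have "z * (B - m) < B - m"
          using z mAB mult_strict_right_mono[of z 1 "B - m"] by (simp only: mult_1) auto
        then have "\<not> B - z * (B - m) \<le> m" "B - z * (B - m) \<le> B" using * by linarith+
        then show ?thesis using mAB by (simp add: H_def)
      qed
      moreover have "A \<le> B - z * (B - m)" "B - z * (B - m) \<le> A + of_int n"
        using * mAB AB by linarith+
      ultimately show ?thesis using lift_curve[of "B - z * (B - m)"] by (simp add: p2_def)
    qed
    ultimately show ?thesis by (simp add: image_image)
  qed
  finally have set: "lift h ` pcurve vs =
      ?R \<union> (\<lambda>z. spatial (p1 z) z) ` {0..1} \<union> (\<lambda>z. spatial (p2 z) z) ` {0..1}" .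
  have BA: "0 < B - A" using mAB by simp
  have m_param: "m \<in> crossing_params" using m q by (auto simp: crossing_params_def)
  obtain d u where u: "0 < d" "u \<noteq> 0" "\<And>x. \<bar>x\<bar> \<le> d \<Longrightarrow> shadow (m + x) = shadow m + x *\<^sub>R u"
    using shadow_straight_at_crossing[of m] m_param unfolding crossing_params_def by blast
  have "ambient_isotopic
     (?R \<union> (\<lambda>z. spatial (p1 z) z) ` {0..1} \<union> (\<lambda>z. spatial (p2 z) z) ` {0..1})
     (?R \<union> (\<lambda>z. spatial (of_real (1 - z) * p1 0) z) ` {0..1} \<union>
          (\<lambda>z. spatial (of_real (1 - z) * p2 0) z) ` {0..1})"
  proof (rule cap_isotopic)
    show "continuous_on {0..1} p1" unfolding p1_def
      by (intro continuous_on_cpx continuous_on_compose2[OF continuous_shadow[of UNIV]] continuous_intros) auto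
    show "continuous_on {0..1} p2" unfolding p2_def
      by (intro continuous_on_cpx continuous_on_compose2[OF continuous_shadow[of UNIV]] continuous_intros) auto
    \<comment> \<open>Equal points would give crossing parameters strictly on either side of
      \<open>m\<close> within the collar. The only candidates are \<open>b\<close> and
      \<open>e\<close>, and \<open>m\<close> is one of them.\<close>
    show "p1 z \<noteq> p2 z" if z: "0 \<le> z" "z < 1" for z
    proof
      assume "p1 z = p2 z"
      define s t where "s = A + z * (m - A)" and "t = B - z * (B - m)"
      have "z * (m - A) < m - A" "z * (B - m) < B - m"
        using z mAB mult_strict_right_mono[of z 1 "m - A"] mult_strict_right_mono[of z 1 "B - m"]
        by (simp_all only: mult_1 diff_gt_0_iff_gt)
      moreover have "0 \<le> z * (m - A)" "0 \<le> z * (B - m)" using z mAB by auto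
      ultimately have st: "A \<le> s" "s < m" "m < t" "t \<le> B" unfolding s_def t_def by linarith+
      have "shadow s = shadow t" using \<open>p1 z = p2 z\<close> by (simp add: p1_def p2_def s_def t_def cpx_eq_iff)
      moreover have "curve s \<noteq> curve t" using curve_inj_short[of s t] st AB by auto
      ultimately have "s \<in> crossing_params" "t \<in> crossing_params"
        using shadow_crossing_iff[of s] shadow_crossing_iff[of t] unfolding crossing_params_def mem_Collect_eq by metis+
      then have "s = b \<or> s = e" "t = b \<or> t = e" using crossing_params_in_AB st mAB by auto
      then show False using m st be by auto
    qed
    \<comment> \<open>Near the peak the strands are at the parameters
      \<open>m - (1 - z) * (m - A)\<close> and \<open>m + (1 - z) * (B - m)\<close> of a straight
      piece with direction \<open>u\<close>; their difference is \<open>1 - z\<close> times this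
      vector.\<close>
    show "- (of_real (B - A) * cpx u) \<noteq> 0"
    proof -
      have "cpx u \<noteq> 0" using u(2) by (auto simp: cpx_def complex_eq_iff prod_eq_iff)
      moreover have "complex_of_real (B - A) \<noteq> 0" using BA by (simp del: of_real_diff)
      ultimately show ?thesis by (simp del: of_real_diff)
    qed
    \<comment> \<open>On the last \<open>d / (B - A)\<close> of the height both parameters are
      within \<open>d\<close> of \<open>m\<close>.\<close>
    show "0 < min 1 (d / (B - A))" "min 1 (d / (B - A)) \<le> 1" using u(1) BA by simp_all
    show "p1 z - p2 z = of_real (1 - z) * (- (of_real (B - A) * cpx u))"
      if z: "1 - min 1 (d / (B - A)) \<le> z" "z \<le> 1" for z
    proof -
      have "1 - z \<le> d / (B - A)" using z by linarith
      then have d: "(1 - z) * (B - A) \<le> d" using pos_le_divide_eq[OF BA] by blast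
      have "(1 - z) * (m - A) \<le> (1 - z) * (B - A)" "(1 - z) * (B - m) \<le> (1 - z) * (B - A)"
        using z mAB by (auto intro: mult_left_mono)
      then have x: "\<bar>- ((1 - z) * (m - A))\<bar> \<le> d" "\<bar>(1 - z) * (B - m)\<bar> \<le> d"
        using d z mAB by (simp_all add: abs_mult)
      have "A + z * (m - A) = m + - ((1 - z) * (m - A))" "B - z * (B - m) = m + (1 - z) * (B - m)"
        by (simp_all add: algebra_simps)
      then have p: "p1 z = cpx (shadow m) + of_real (- ((1 - z) * (m - A))) * cpx u"
        "p2 z = cpx (shadow m) + of_real ((1 - z) * (B - m)) * cpx u"
        unfolding p1_def p2_def using u(3)[OF x(1)] u(3)[OF x(2)] by (simp_all only: cpx_add_scaleR)
      show ?thesis unfolding p by (simp add: algebra_simps)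
    qed
    show "z \<le> 0" if R: "(x, y, z) \<in> ?R" for x y z
    proof -
      obtain s where "B \<le> s" "s \<le> A + of_int n" "z = rest s" using R by (auto simp: spatial_def)
      then show ?thesis using rest_nonpos[of s] by simp
    qed
  qed
  then show ?thesis unfolding set by (simp add: p1_def p2_def)
qed

end

section \<open>Toggling the crossing of a loop and discarding regions\<close>

lemma yields_unknot_iff_lift:
  "yields_unknot vs X \<longleftrightarrow> (\<exists>h. continuous_on (pcurve vs) h \<and>
     (\<forall>p1\<in>pcurve vs. \<forall>p2\<in>pcurve vs. proj p1 = proj p2 \<and> p1 \<noteq> p2 \<longrightarrow>
        (h p1 < h p2 \<longleftrightarrow> ((height p1 < height p2) \<longleftrightarrow> proj p1 \<notin> X))) \<and>
     is_unknot (lift h ` pcurve vs))"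
  by (simp add: yields_unknot_def lift_def)

lemma height_neq: "proj p1 = proj p2 \<Longrightarrow> p1 \<noteq> p2 \<Longrightarrow> height p1 \<noteq> height p2"
  by (auto simp: proj_def height_def prod_eq_iff)

context diagram begin

text \<open>Hence the existentially chosen height in \<open>yields_unknot\<close> may be replaced by
  any other with the same order.\<close>

lemma lift_isotopic_same_order:
  assumes "continuous_on (pcurve vs) h" "continuous_on (pcurve vs) h'"
    and "\<And>p1 p2. p1 \<in> pcurve vs \<Longrightarrow> p2 \<in> pcurve vs \<Longrightarrow> proj p1 = proj p2 \<Longrightarrow> p1 \<noteq> p2 \<Longrightarrow>
      h p1 < h p2 \<and> h' p1 < h' p2 \<or> h p2 < h p1 \<and> h' p2 < h' p1"
  shows "ambient_isotopic (lift h ` pcurve vs) (lift h' ` pcurve vs)"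
  by (rule lift_isotopic[OF compact_pcurve assms(1,2)])
     (use finite_crossings card_fibre assms(3) in \<open>auto simp: crossings_def\<close>)

text \<open>The heights \<open>h0\<close> and \<open>h1\<close> have the same order; the lifts by
  \<open>h1\<close> and \<open>h2\<close> share the cap; \<open>h2\<close> differs in order from
  \<open>h0\<close> exactly at \<open>q\<close>.\<close>

lemma yields_unknot_toggle:
  assumes R: "R \<in> regions vs" and Rq: "{x \<in> crossings vs. x \<in> frontier R} = {q}"
    and X: "yields_unknot vs X"
    and Y: "\<And>x. x \<in> crossings vs \<Longrightarrow> x \<in> Y \<longleftrightarrow> (x \<in> X) \<noteq> (x = q)"
  shows "yields_unknot vs Y"
proof -
  have q: "q \<in> crossings vs" using Rq by blast
  obtain b e where loop: "b < e" "e < b + of_int n" "shadow b = q" "shadow e = q"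
    "\<And>t. b < t \<Longrightarrow> t < e \<Longrightarrow> shadow t \<notin> crossings vs"
    using crossing_loop[OF R Rq] by blast
  have "b \<in> crossing_params" "e \<in> crossing_params" using loop q by (auto simp: crossing_params_def)
  then obtain \<epsilon> where \<epsilon>: "0 < \<epsilon>" "e + \<epsilon> < b - \<epsilon> + of_int n"
    "\<And>t. b - 2 * \<epsilon> \<le> t \<Longrightarrow> t < b \<Longrightarrow> t \<notin> crossing_params" "\<And>t. e < t \<Longrightarrow> t \<le> e + 2 * \<epsilon> \<Longrightarrow> t \<notin> crossing_params"
    using loop_collar[OF loop(1,2)] by blast
  obtain h0 where h0: "continuous_on (pcurve vs) h0"
    and order: "\<And>p1 p2. p1 \<in> pcurve vs \<Longrightarrow> p2 \<in> pcurve vs \<Longrightarrow> proj p1 = proj p2 \<Longrightarrow> p1 \<noteq> p2 \<Longrightarrow>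
        h0 p1 < h0 p2 \<longleftrightarrow> ((height p1 < height p2) \<longleftrightarrow> proj p1 \<notin> X)"
    and unknot: "is_unknot (lift h0 ` pcurve vs)"
    using X unfolding yields_unknot_iff_lift by blast
  have "bdd_above (h0 ` pcurve vs)"
    by (intro bounded_imp_bdd_above compact_imp_bounded compact_continuous_image h0 compact_pcurve)
  then obtain M where M: "\<And>p. p \<in> pcurve vs \<Longrightarrow> h0 p \<le> M" unfolding bdd_above_def by blast
  interpret loop_diagram vs b e \<epsilon> q h0 M
    by unfold_locales (use loop q \<epsilon> h0 M in \<open>auto simp: crossing_params_def\<close>)
  have strict: "h0 p1 < h0 p2 \<or> h0 p2 < h0 p1"
    if "p1 \<in> pcurve vs" "p2 \<in> pcurve vs" "proj p1 = proj p2" "p1 \<noteq> p2" for p1 p2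
    using order[OF that] order[OF that(2,1) that(3)[symmetric] that(4)[symmetric]] height_neq[OF that(3,4)] that(3)
    by (auto simp: not_less_iff_gr_or_eq)
  have cbe: "curve b \<in> pcurve vs" "curve e \<in> pcurve vs" "proj (curve b) = q" "proj (curve e) = q"
    using fibre_q by blast+
  have at_q: "p1 = curve b \<and> p2 = curve e \<or> p1 = curve e \<and> p2 = curve b"
    if "p1 \<in> pcurve vs" "p2 \<in> pcurve vs" "proj p1 = proj p2" "p1 \<noteq> p2" "proj p1 = q" for p1 p2
  proof -
    have "p1 \<in> {curve b, curve e}" "p2 \<in> {curve b, curve e}" using that unfolding fibre_q[symmetric] by auto
    then show ?thesis using that(4) by auto
  qed
  \<comment> \<open>The peak \<open>m\<close> is put on the strand that \<open>h0\<close> has on top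
    at \<open>q\<close>, and \<open>m'\<close> on the other.\<close>
  define m m' where "m = (if h0 (curve b) < h0 (curve e) then e else b)"
    and "m' = (if h0 (curve b) < h0 (curve e) then b else e)"
  have mm: "m = b \<or> m = e" "m' = b \<or> m' = e" by (auto simp: m_def m'_def)
  obtain h1 where h1: "continuous_on (pcurve vs) h1"
      "\<forall>s\<in>{A..A + of_int n}. h1 (curve s) = H m s"
    using ex_height[OF mm(1)] by blast
  obtain h2 where h2: "continuous_on (pcurve vs) h2"
      "\<forall>s\<in>{A..A + of_int n}. h2 (curve s) = H m' s"
    using ex_height[OF mm(2)] by blast
  note hc1 = height_at_crossings[OF mm(1) h1(2)]
  note hc2 = height_at_crossings[OF mm(2) h2(2)]
  have sbe: "h0 (curve b) < h0 (curve e) \<or> h0 (curve e) < h0 (curve b)" using strict cbe curve_be by simp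
  have q1: "h1 (curve b) < h1 (curve e) \<longleftrightarrow> h0 (curve b) < h0 (curve e)" "h1 (curve e) < h1 (curve b) \<longleftrightarrow> h0 (curve e) < h0 (curve b)"
    unfolding hc1(2,3) using sbe be by (auto simp: m_def)
  have q2: "h2 (curve b) < h2 (curve e) \<longleftrightarrow> h0 (curve e) < h0 (curve b)" "h2 (curve e) < h2 (curve b) \<longleftrightarrow> h0 (curve b) < h0 (curve e)"
    unfolding hc2(2,3) using sbe be by (auto simp: m'_def)
  have "ambient_isotopic (lift h0 ` pcurve vs) (lift h1 ` pcurve vs)"
  proof (rule lift_isotopic_same_order[OF h0 h1(1)])
    fix p1 p2 assume p: "p1 \<in> pcurve vs" "p2 \<in> pcurve vs" "proj p1 = proj p2" "p1 \<noteq> p2"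
    show "h0 p1 < h0 p2 \<and> h1 p1 < h1 p2 \<or> h0 p2 < h0 p1 \<and> h1 p2 < h1 p1"
    proof (cases "proj p1 = q")
      case True
      with at_q[OF p] q1 sbe show ?thesis by auto
    next
      case False
      with hc1(1)[OF p(1,2,4,3)] strict[OF p] show ?thesis by auto
    qed
  qed
  moreover have "ambient_isotopic (lift h1 ` pcurve vs) (lift h2 ` pcurve vs)"
    using ambient_isotopic_trans[OF lift_isotopic_cap[OF mm(1) h1(2)]
        ambient_isotopic_sym[OF lift_isotopic_cap[OF mm(2) h2(2)]]] by blast
  ultimately have "is_unknot (lift h2 ` pcurve vs)"
    using unknot is_unknot_cong by blast
  moreover have "h2 p1 < h2 p2 \<longleftrightarrow> ((height p1 < height p2) \<longleftrightarrow> proj p1 \<notin> Y)"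
    if p: "p1 \<in> pcurve vs" "p2 \<in> pcurve vs" "proj p1 = proj p2" "p1 \<noteq> p2" for p1 p2
  proof -
    have "proj p1 \<in> crossings vs" using p unfolding crossings_iff by metis
    note Y' = Y[OF this]
    show ?thesis
    proof (cases "proj p1 = q")
      case True
      have "h2 p1 < h2 p2 \<longleftrightarrow> h0 p2 < h0 p1" using at_q[OF p True] q2 by auto
      also have "\<dots> \<longleftrightarrow> \<not> h0 p1 < h0 p2" using strict[OF p] by auto
      finally show ?thesis using order[OF p] Y' True by blast
    next
      case False
      have "h2 p1 < h2 p2 \<longleftrightarrow> h0 p1 < h0 p2" using hc2(1)[OF p(1,2,4,3) False] by auto
      then show ?thesis using order[OF p] Y' False by blast
    qed
  qed
  ultimately show ?thesis unfolding yields_unknot_iff_lift using h2(1) by blast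
qed

lemma yields_unknot_cong:
  assumes "yields_unknot vs X" "\<And>x. x \<in> crossings vs \<Longrightarrow> x \<in> X \<longleftrightarrow> x \<in> Y"
  shows "yields_unknot vs Y"
proof -
  have "proj p1 \<in> X \<longleftrightarrow> proj p1 \<in> Y"
    if "p1 \<in> pcurve vs" "p2 \<in> pcurve vs" "proj p1 = proj p2 \<and> p1 \<noteq> p2" for p1 p2
    by (rule assms(2)) (use that in \<open>unfold crossings_iff, metis\<close>)
  moreover obtain h where "continuous_on (pcurve vs) h" "is_unknot (lift h ` pcurve vs)"
    "\<forall>p1\<in>pcurve vs. \<forall>p2\<in>pcurve vs. proj p1 = proj p2 \<and> p1 \<noteq> p2 \<longrightarrow>
        (h p1 < h p2 \<longleftrightarrow> ((height p1 < height p2) \<longleftrightarrow> proj p1 \<notin> X))"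
    using assms(1) unfolding yields_unknot_iff_lift by blast
  ultimately show ?thesis unfolding yields_unknot_iff_lift by (intro exI[of _ h]) simp
qed

lemma unknotting_regions_finite: "unknotting_regions vs S \<Longrightarrow> finite S"
  using finite_regions knot_diagram unfolding unknotting_regions_def knot_diagram_def
  by (meson finite_subset)

text \<open>Dropping \<open>R\<close> flips the parity exactly at the crossings on its frontier: at
  none, or at the single crossing of a loop.\<close>

lemma unknotting_regions_remove:
  assumes S: "unknotting_regions vs S" and R: "R \<in> S" "creg vs R \<le> 1"
  shows "unknotting_regions vs (S - {R})"
proof -
  have fin: "finite S" by (rule unknotting_regions_finite[OF S])
  have Sr: "S \<subseteq> regions vs" and X: "yields_unknot vs (changed_crossings vs S)"
    using S by (auto simp: unknotting_regions_def)
  have card: "card {R' \<in> S. x \<in> frontier R'} =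
      card {R' \<in> S - {R}. x \<in> frontier R'} + (if x \<in> frontier R then 1 else 0)" for x
  proof (cases "x \<in> frontier R")
    case True
    then have "{R' \<in> S. x \<in> frontier R'} = insert R {R' \<in> S - {R}. x \<in> frontier R'}" using R by auto
    then show ?thesis using fin True by simp
  next
    case False
    then have "{R' \<in> S. x \<in> frontier R'} = {R' \<in> S - {R}. x \<in> frontier R'}" by auto
    then show ?thesis using False by simp
  qed
  have changed: "x \<in> changed_crossings vs (S - {R}) \<longleftrightarrow>
      (x \<in> changed_crossings vs S) \<noteq> (x \<in> frontier R)" if "x \<in> crossings vs" for x
    using that by (simp add: changed_crossings_def card[of x])
  let ?Q = "{x \<in> crossings vs. x \<in> frontier R}"
  have finQ: "finite ?Q" using finite_crossings by simp
  have "card ?Q = 0 \<or> card ?Q = 1" using R(2) unfolding creg_def by linarith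
  then have "yields_unknot vs (changed_crossings vs (S - {R}))"
  proof
    assume "card ?Q = 0"
    then have "?Q = {}" using finQ by simp
    then show ?thesis using changed by (intro yields_unknot_cong[OF X]) blast
  next
    assume "card ?Q = 1"
    then obtain q where q: "?Q = {q}" by (auto simp: card_1_singleton_iff)
    show ?thesis
      by (rule yields_unknot_toggle[OF subsetD[OF Sr R(1)] q X]) (use changed q in blast)
  qed
  then show ?thesis using Sr by (auto simp: unknotting_regions_def)
qed

text \<open>The region kept is one with the most crossings. Any other has at most as many, and the
  two together have at most 3, so the other has at most 1. The bound concerns each region separately
  and persists as regions are removed one by one.\<close>

lemma single_unknotting_region:
  assumes S: "unknotting_regions vs S" and ne: "S \<noteq> {}" and le: "(\<Sum>R\<in>S. creg vs R) \<le> 3"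
  obtains R where "R \<in> S" "unknotting_regions vs {R}"
proof -
  have fin: "finite S" by (rule unknotting_regions_finite[OF S])
  obtain R where R: "R \<in> S" "\<And>R'. R' \<in> S \<Longrightarrow> creg vs R' \<le> creg vs R"
    using arg_max_nat_lemma[of "\<lambda>R. R \<in> S" _ "creg vs" "Suc (Max (creg vs ` S))"] ne fin
    by (metis (no_types, lifting) Max_ge empty_iff finite_imageI image_eqI le_imp_less_Suc equals0I)
  have small: "creg vs R' \<le> 1" if "R' \<in> S - {R}" for R'
  proof -
    have "R' \<noteq> R" using that by simp
    then have "creg vs R + creg vs R' = (\<Sum>R\<in>{R, R'}. creg vs R)" by simp
    also have "\<dots> \<le> (\<Sum>R\<in>S. creg vs R)" using that R fin by (intro sum_mono2) auto
    finally show ?thesis using le R(2)[of R'] that by auto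
  qed
  have "unknotting_regions vs (S - T)" if "finite T" "T \<subseteq> S - {R}" for T
    using that
  proof (induction T rule: finite_induct)
    case empty
    then show ?case using S by simp
  next
    case (insert R' T)
    then have "unknotting_regions vs (S - T - {R'})"
      by (intro unknotting_regions_remove small) auto
    moreover have "S - T - {R'} = S - insert R' T" by auto
    ultimately show ?case by simp
  qed
  from this[of "S - {R}"] have "unknotting_regions vs (S - (S - {R}))" using fin by simp
  moreover have "S - (S - {R}) = {R}" using R by auto
  ultimately show thesis using that R by simp
qed

text \<open>The lift by \<open>height\<close> is the knot itself, and an empty set of changes asks
  for the same order.\<close>

lemma is_unknot_if_unknotting_regions_empty:
  assumes "unknotting_regions vs {}"
  shows "is_unknot (pcurve vs)"
proof -
  have "changed_crossings vs {} = {}" by (simp add: changed_crossings_def)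
  then have "yields_unknot vs {}" using assms by (simp add: unknotting_regions_def)
  then obtain h where h: "continuous_on (pcurve vs) h"
    and order: "\<And>p1 p2. p1 \<in> pcurve vs \<Longrightarrow> p2 \<in> pcurve vs \<Longrightarrow> proj p1 = proj p2 \<Longrightarrow> p1 \<noteq> p2 \<Longrightarrow>
        h p1 < h p2 \<longleftrightarrow> height p1 < height p2"
    and unknot: "is_unknot (lift h ` pcurve vs)"
    unfolding yields_unknot_iff_lift by auto
  have "lift height ` pcurve vs = pcurve vs" by (simp add: lift_def height_def)
  moreover have "ambient_isotopic (lift h ` pcurve vs) (lift height ` pcurve vs)"
  proof (rule lift_isotopic_same_order[OF h])
    show "continuous_on (pcurve vs) height"
      unfolding height_def by (intro continuous_intros)
    fix p1 p2 assume p: "p1 \<in> pcurve vs" "p2 \<in> pcurve vs" "proj p1 = proj p2" "p1 \<noteq> p2"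
    show "h p1 < h p2 \<and> height p1 < height p2 \<or> h p2 < h p1 \<and> height p2 < height p1"
      using order[OF p] order[OF p(2,1) p(3)[symmetric] p(4)[symmetric]] height_neq[OF p(3,4)] by linarith
  qed
  ultimately show ?thesis using is_unknot_cong[OF unknot] by simp
qed

end

section \<open>A diagram of the unknot without crossings\<close>

text \<open>A factor depending only on the direction has in general no limit at the origin;
  boundedness still makes the product tend to 0.\<close>

lemma continuous_on_bounded_scaling:
  fixes f :: "real \<times> real \<Rightarrow> real"
  assumes f: "continuous_on (- {0}) f" and bd: "\<And>w. \<bar>f w\<bar> \<le> C"
  shows "continuous_on UNIV (\<lambda>w. f w *\<^sub>R w)"
proof -
  have "isCont (\<lambda>w. f w *\<^sub>R w) w" for w
  proof (cases "w = 0")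
    case True
    have "((\<lambda>w::real \<times> real. C * norm w) \<longlongrightarrow> C * norm (0::real \<times> real)) (at 0)"
      by (intro tendsto_intros)
    then have lim: "((\<lambda>w::real \<times> real. C * norm w) \<longlongrightarrow> 0) (at 0)" by simp
    have "norm (f w *\<^sub>R w) \<le> C * norm w" for w
      using mult_right_mono[OF bd norm_ge_zero] by simp
    then have "((\<lambda>w. f w *\<^sub>R w) \<longlongrightarrow> 0) (at 0)"
      by (intro Lim_null_comparison[OF _ lim] always_eventually allI)
    then show ?thesis using True by (simp add: isCont_def)
  next
    case False
    then have "isCont f w" using f by (simp add: continuous_on_eq_continuous_at open_Compl)
    then show ?thesis by (intro continuous_intros)
  qed
  then show ?thesis by (simp add: continuous_at_imp_continuous_on)
qed

text \<open>The gauge whose unit circle is the boundary of the triangle below.\<close>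

definition gauge3 :: "real \<times> real \<Rightarrow> real" where
  "gauge3 w = max (- fst w) (fst w + 2 * \<bar>snd w\<bar>)"

text \<open>The first branch of the maximum bounds \<open>- fst w\<close>, the second bounds
  \<open>fst w\<close>, and their sum bounds \<open>\<bar>snd w\<bar>\<close>.\<close>

lemma gauge3_bounds: "norm w \<le> 2 * gauge3 w" "gauge3 w \<le> 3 * norm w"
proof -
  have "norm w \<le> \<bar>fst w\<bar> + \<bar>snd w\<bar>" using norm_Pair_le[of "fst w" "snd w"] by simp
  moreover have "- fst w \<le> gauge3 w" "fst w + 2 * \<bar>snd w\<bar> \<le> gauge3 w" by (simp_all add: gauge3_def)
  ultimately show "norm w \<le> 2 * gauge3 w" by linarith
  have "\<bar>fst w\<bar> \<le> norm w" "\<bar>snd w\<bar> \<le> norm w"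
    by (metis norm_fst_le norm_snd_le prod.collapse real_norm_def)+
  then show "gauge3 w \<le> 3 * norm w" unfolding gauge3_def by linarith
qed

lemma gauge3_pos: "w \<noteq> 0 \<Longrightarrow> 0 < gauge3 w"
  using gauge3_bounds(1)[of w] by (smt (verit) norm_le_zero_iff zero_less_norm_iff)

lemma gauge3_scaleR: "0 \<le> k \<Longrightarrow> gauge3 (k *\<^sub>R w) = k * gauge3 w"
  by (simp add: gauge3_def abs_mult max_mult_distrib_left distrib_left)

definition triangle :: "point3 list" where "triangle = [(1, 0, 0), (-1, 1, 0), (-1, -1, 0)]"

lemma closed_segment_iff:
  fixes p q :: point3
  shows "(x, y, z) \<in> closed_segment p q \<longleftrightarrow> (\<exists>u. 0 \<le> u \<and> u \<le> 1 \<and>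
    x = fst p + u * (fst q - fst p) \<and> y = fst (snd p) + u * (fst (snd q) - fst (snd p)) \<and>
    z = snd (snd p) + u * (snd (snd q) - snd (snd p)))"
  by (cases p; cases q) (auto simp: in_segment algebra_simps)

lemma pedge_triangle:
  "pedge triangle 0 = {(x, y, z). z = 0 \<and> x = 1 - 2 * y \<and> 0 \<le> y \<and> y \<le> 1}"
  "pedge triangle 1 = {(x, y, z). z = 0 \<and> x = -1 \<and> -1 \<le> y \<and> y \<le> 1}"
  "pedge triangle 2 = {(x, y, z). z = 0 \<and> x = 1 + 2 * y \<and> -1 \<le> y \<and> y \<le> 0}"
proof -
  show "pedge triangle 0 = {(x, y, z). z = 0 \<and> x = 1 - 2 * y \<and> 0 \<le> y \<and> y \<le> 1}"
    by (auto simp: pedge_def triangle_def closed_segment_iff)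
  show "pedge triangle 1 = {(x, y, z). z = 0 \<and> x = -1 \<and> -1 \<le> y \<and> y \<le> 1}"
  proof -
    have "\<exists>u. 0 \<le> u \<and> u \<le> 1 \<and> y = 1 - u * 2" if "-1 \<le> y" "y \<le> 1" for y :: real
      by (rule exI[of _ "(1 - y) / 2"]) (use that in \<open>simp add: field_simps\<close>)
    then show ?thesis
      by (auto simp: pedge_def triangle_def closed_segment_iff)
  qed
  show "pedge triangle 2 = {(x, y, z). z = 0 \<and> x = 1 + 2 * y \<and> -1 \<le> y \<and> y \<le> 0}"
  proof -
    have "\<exists>u. 0 \<le> u \<and> u \<le> 1 \<and> 1 + 2 * y = - 1 + u * 2 \<and> y = - 1 + u" if "-1 \<le> y" "y \<le> 0" for y :: real
      by (rule exI[of _ "y + 1"]) (use that in auto)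
    then show ?thesis
      by (auto simp: pedge_def triangle_def closed_segment_iff)
  qed
qed

lemma all_less_3: "(\<forall>i<3::nat. Q i) \<longleftrightarrow> Q 0 \<and> Q 1 \<and> Q 2"
  by (auto simp: numeral_3_eq_3 numeral_2_eq_2 All_less_Suc)

lemma pcurve_triangle: "pcurve triangle = {(x, y, z). z = 0 \<and> gauge3 (x, y) = 1}"
proof -
  have "{..<3::nat} = {0, 1, 2}" by auto
  moreover have "length triangle = 3" by (simp add: triangle_def)
  ultimately have "pcurve triangle = (\<Union>i\<in>{0, 1, 2}. pedge triangle i)"
    unfolding pcurve_def by (simp only:)
  then have "pcurve triangle = pedge triangle 0 \<union> pedge triangle 1 \<union> pedge triangle 2" by auto
  then show ?thesis unfolding pedge_triangle by (auto simp: gauge3_def)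
qed

lemma polygonal_knot_triangle: "polygonal_knot triangle"
proof -
  have len: "length triangle = 3" by (simp add: triangle_def)
  have nth: "triangle ! 0 = (1, 0, 0)" "triangle ! 1 = (-1, 1, 0)" "triangle ! 2 = (-1, -1, 0)"
    by (simp_all add: triangle_def)
  have int: "pedge triangle 0 \<inter> pedge triangle 1 = {triangle ! 1}" "pedge triangle 1 \<inter> pedge triangle 2 = {triangle ! 2}"
    "pedge triangle 2 \<inter> pedge triangle 0 = {triangle ! 0}"
    unfolding pedge_triangle nth by auto
  have "\<forall>i<3. \<forall>j<3. i \<noteq> j \<longrightarrow> pedge triangle i \<inter> pedge triangle j =
          (if j = Suc i mod 3 then {triangle ! j} else if i = Suc j mod 3 then {triangle ! i} else {})"
    unfolding all_less_3 using int by (auto simp: Int_commute numeral_2_eq_2)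
  moreover have "distinct triangle" by (simp add: triangle_def)
  ultimately show ?thesis unfolding polygonal_knot_def len by simp
qed

lemma crossings_triangle: "crossings triangle = {}"
  by (auto simp: crossings_def pcurve_triangle proj_def)

lemma knot_diagram_triangle: "knot_diagram triangle"
proof -
  have len: "length triangle = 3" by (simp add: triangle_def)
  have "\<forall>i<3. proj (triangle ! i) \<noteq> proj (triangle ! (Suc i mod 3))"
    unfolding all_less_3 by (simp add: triangle_def proj_def)
  then show ?thesis
    using polygonal_knot_triangle by (simp add: knot_diagram_def regular_proj_def crossings_triangle len)
qed

text \<open>A radial isotopy of the horizontal coordinates. The factor \<open>k\<close> depends only
  on time and direction, so dividing by it is the inverse, and at time 1 the gauge of the image is
  the norm of the point.\<close>

lemma std_unknot_isotopic_triangle: "ambient_isotopic std_unknot (pcurve triangle)"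
proof -
  define s where "s = (\<lambda>w. norm w / gauge3 w)"
  define k where "k = (\<lambda>t w. 1 - t + t * s w)"
  define H where "H = (\<lambda>(t, x, y, z :: real). (fst (k t (x, y) *\<^sub>R (x, y)), snd (k t (x, y) *\<^sub>R (x, y)), z))"
  define G where "G = (\<lambda>t (x, y, z :: real).
     (fst (inverse (k t (x, y)) *\<^sub>R (x, y)), snd (inverse (k t (x, y)) *\<^sub>R (x, y)), z))"
  have cg: "continuous_on S gauge3" for S
    unfolding gauge3_def by (intro continuous_intros)
  have cs: "continuous_on (- {0}) s"
    unfolding s_def using gauge3_pos by (intro continuous_intros cg) (metis ComplD insertI1 less_irrefl)
  have s_bounds: "1 / 3 \<le> s w \<and> s w \<le> 2" if "w \<noteq> 0" for w
    using gauge3_bounds[of w] gauge3_pos[OF that] by (simp add: s_def field_simps)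
  have s0: "s 0 = 0" by (simp add: s_def)
  have s_abs: "\<bar>s w\<bar> \<le> 2" for w using s_bounds[of w] s0 by (cases "w = 0") auto
  have k_ge: "1 / 3 \<le> k t w" if "t \<in> {0..1}" "w \<noteq> 0" for t w
  proof -
    have "t * (1 / 3) \<le> t * s w" using that s_bounds[of w] by (intro mult_left_mono) auto
    then show ?thesis using that by (auto simp: k_def)
  qed
  have s_scale: "s (r *\<^sub>R w) = s w" if "0 < r" for r w
    using that by (simp add: s_def gauge3_scaleR)
  have k_scale: "k t (r *\<^sub>R w) = k t w" if "0 < r" for r t w
    using s_scale[OF that] by (simp add: k_def)
  have csw: "continuous_on UNIV (\<lambda>w. s w *\<^sub>R w)"
    by (rule continuous_on_bounded_scaling[OF cs s_abs])
  \<comment> \<open>The factor may jump at the origin; joint continuity is read off from this sum,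
    where only \<open>s w *\<^sub>R w\<close> needs the bounded scaling argument.\<close>
  have kw: "k t w *\<^sub>R w = (1 - t) *\<^sub>R w + t *\<^sub>R (s w *\<^sub>R w)" for t w
    by (simp add: k_def scaleR_add_left)
  show ?thesis
  proof (rule ambient_isotopicI[of H G])
    show "continuous_on ({0..1} \<times> UNIV) H"
      unfolding H_def case_prod_unfold kw
      by (intro continuous_intros continuous_on_compose2[OF csw]) auto
    show "continuous_on UNIV (G t)" if t: "t \<in> {0..1}" for t
    proof -
      \<comment> \<open>At the origin \<open>k t\<close> is \<open>1 - t\<close>, whose inverse can
        exceed 3; the value 0 there keeps the factor bounded without altering the product.\<close>
      have "continuous_on UNIV (\<lambda>w. (if w = 0 then 0 else inverse (k t w)) *\<^sub>R w)"
      proof (rule continuous_on_bounded_scaling[where C = 3])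
        have "continuous_on (- {0}) (\<lambda>w. inverse (k t w))"
          unfolding k_def
        proof (intro continuous_intros cs)
          show "\<forall>w\<in>- {0}. 1 - t + t * s w \<noteq> 0"
            using k_ge[OF t] by (force simp: k_def)
        qed
        then show "continuous_on (- {0}) (\<lambda>w. if w = 0 then 0 else inverse (k t w))"
          by (rule continuous_on_eq) auto
        show "\<bar>if w = 0 then 0 else inverse (k t w)\<bar> \<le> 3" for w
        proof (cases "w = 0")
          case False
          then have "inverse (k t w) \<le> inverse (1 / 3)" by (intro le_imp_inverse_le k_ge t) auto
          moreover have "0 < k t w" using k_ge[OF t False] by simp
          ultimately show ?thesis using False by simp
        qed simp
      qed
      moreover have "(if w = 0 then 0 else inverse (k t w)) *\<^sub>R w = inverse (k t w) *\<^sub>R w" for w :: "real \<times> real"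
        by simp
      ultimately have cont: "continuous_on UNIV (\<lambda>w. inverse (k t w) *\<^sub>R w)" by simp
      show ?thesis unfolding G_def case_prod_unfold
        by (intro continuous_intros continuous_on_compose2[OF cont]) auto
    qed
    show "G t (H (t, x)) = x" if t: "t \<in> {0..1}" for t x
    proof -
      obtain u v z where x: "x = (u, v, z)" by (cases x)
      have "inverse (k t (k t w *\<^sub>R w)) *\<^sub>R (k t w *\<^sub>R w) = w" for w
      proof (cases "w = 0")
        case False
        then have "0 < k t w" using k_ge[OF t False] by simp
        then show ?thesis by (simp add: k_scale)
      qed simp
      from this[of "(u, v)"] show ?thesis unfolding x G_def H_def prod.case
        by (simp only: prod.collapse fst_conv snd_conv)
    qed
    show "H (t, G t x) = x" if t: "t \<in> {0..1}" for t x
    proof -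
      obtain u v z where x: "x = (u, v, z)" by (cases x)
      have "k t (inverse (k t w) *\<^sub>R w) *\<^sub>R (inverse (k t w) *\<^sub>R w) = w" for w
      proof (cases "w = 0")
        case False
        then have "0 < k t w" using k_ge[OF t False] by simp
        then show ?thesis by (simp add: k_scale)
      qed simp
      from this[of "(u, v)"] show ?thesis unfolding x G_def H_def prod.case
        by (simp only: prod.collapse fst_conv snd_conv)
    qed
    show "H (0, x) = x" for x by (cases x) (simp add: H_def k_def)
    have H1: "H (1, x, y, z) = (fst (s (x, y) *\<^sub>R (x, y)), snd (s (x, y) *\<^sub>R (x, y)), z)" for x y z
      by (simp add: H_def k_def)
    show "(\<lambda>x. H (1, x)) ` std_unknot = pcurve triangle"
    proof
      show "(\<lambda>x. H (1, x)) ` std_unknot \<subseteq> pcurve triangle"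
      proof (clarsimp simp only: image_subset_iff std_unknot_def mem_Collect_eq case_prod_conv)
        fix x y :: real assume "x\<^sup>2 + y\<^sup>2 = 1"
        then have n: "norm (x, y) = 1" by (simp add: norm_Pair)
        then have "0 < gauge3 (x, y)" by (intro gauge3_pos) auto
        then have "gauge3 (s (x, y) *\<^sub>R (x, y)) = 1"
          unfolding s_def n by (subst gauge3_scaleR) auto
        then show "H (1, x, y, 0) \<in> pcurve triangle" unfolding H1 pcurve_triangle by simp
      qed
      show "pcurve triangle \<subseteq> (\<lambda>x. H (1, x)) ` std_unknot"
      proof
        fix p assume "p \<in> pcurve triangle"
        then obtain x y where p: "p = (x, y, 0)" and g: "gauge3 (x, y) = 1"
          unfolding pcurve_triangle by auto
        define r where "r = norm (x, y)"
        have "1 \<le> 3 * r" using g gauge3_bounds(2)[of "(x, y)"] unfolding r_def by linarith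
        then have r: "0 < r" by linarith
        have w: "(x / r, y / r) = inverse r *\<^sub>R (x, y)" by (simp add: divide_inverse mult.commute)
        have "s (x / r, y / r) = r"
          unfolding w using s_scale[of "inverse r" "(x, y)"] r g by (simp add: s_def r_def)
        then have "H (1, x / r, y / r, 0) = p" unfolding H1 p using r by simp
        moreover have "x\<^sup>2 + y\<^sup>2 = r\<^sup>2" by (simp add: r_def norm_Pair)
        have "(x / r)\<^sup>2 + (y / r)\<^sup>2 = (x\<^sup>2 + y\<^sup>2) / r\<^sup>2"
          by (simp add: power_divide add_divide_distrib)
        then have "(x / r)\<^sup>2 + (y / r)\<^sup>2 = 1" unfolding \<open>x\<^sup>2 + y\<^sup>2 = r\<^sup>2\<close> using r by simp
        then have "(x / r, y / r, 0) \<in> std_unknot" by (simp add: std_unknot_def)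
        ultimately show "p \<in> (\<lambda>x. H (1, x)) ` std_unknot" by (metis imageI)
      qed
    qed
  qed
qed

text \<open>The triangle has no crossings, so each of its regions is unknotting at cost 0; one
  exists because a compact shadow does not fill the plane.\<close>

lemma Reg_K_unknot:
  assumes "is_unknot K"
  shows "Reg_K K = 0"
proof -
  have triangle: "ambient_isotopic (pcurve triangle) K"
    using assms ambient_isotopic_trans[OF ambient_isotopic_sym[OF std_unknot_isotopic_triangle]]
    unfolding is_unknot_def by blast
  have "proj ` pcurve triangle \<noteq> UNIV"
    using compact_proj_pcurve[of triangle] not_compact_UNIV[where 'a = "real \<times> real"] by metis
  then obtain R where R: "R \<in> regions triangle"
    unfolding regions_def using components_eq_empty by blast
  have "unknotting_regions triangle {R}"
    unfolding unknotting_regions_def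
  proof
    have nc: "\<not> (proj p1 = proj p2 \<and> p1 \<noteq> p2)" if "p1 \<in> pcurve triangle" "p2 \<in> pcurve triangle" for p1 p2
      using that crossings_triangle unfolding crossings_def by blast
    have "(\<lambda>p. (fst p, fst (snd p), height p)) ` pcurve triangle = pcurve triangle" by (simp add: height_def)
    moreover have "continuous_on (pcurve triangle) height"
      unfolding height_def by (intro continuous_intros)
    ultimately show "yields_unknot triangle (changed_crossings triangle {R})"
      unfolding yields_unknot_def using nc std_unknot_isotopic_triangle
      by (intro exI[of _ height]) (auto simp: is_unknot_def)
  qed (use R in simp)
  then have "Reg_D triangle \<le> enat (creg triangle R)"
    unfolding Reg_D_def using R by (intro INF_lower) simp
  also have "creg triangle R = 0" by (simp add: creg_def crossings_triangle)
  finally have "Reg_D triangle = 0" unfolding zero_enat_def[symmetric] by simp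
  moreover have "Reg_K K \<le> Reg_D triangle"
    unfolding Reg_K_def using triangle knot_diagram_triangle by (intro INF_lower) simp
  ultimately show ?thesis by simp
qed

theorem theorem5:
  fixes K :: "point3 set"
  assumes "tame_knot K"
    and "MRI_K K < Reg_K K"
  shows "MRI_K K \<ge> 4 \<and> Reg_K K \<ge> 5"
proof -
  have "4 \<le> MRI_K K"
  proof (rule ccontr)
    assume "\<not> 4 \<le> MRI_K K"
    \<comment> \<open>Taking the minimum lets one diagram and one set of regions witness both strict
      bounds at once.\<close>
    with assms(2) have "MRI_K K < min 4 (Reg_K K)" by simp
    then obtain vs where vs: "knot_diagram vs" "ambient_isotopic (pcurve vs) K"
      "MRI_D vs < min 4 (Reg_K K)"
      unfolding MRI_K_def INF_less_iff by auto
    then obtain S where S: "unknotting_regions vs S" "enat (\<Sum>R\<in>S. creg vs R) < min 4 (Reg_K K)"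
      unfolding MRI_D_def INF_less_iff by auto
    interpret diagram vs by unfold_locales (rule vs(1))
    have "enat (\<Sum>R\<in>S. creg vs R) < enat 4" using S(2) by (simp add: numeral_eq_enat)
    then have le3: "(\<Sum>R\<in>S. creg vs R) \<le> 3" by simp
    show False
    proof (cases "S = {}")
      case True
      then have "is_unknot K"
        using is_unknot_if_unknotting_regions_empty S(1) is_unknot_cong[OF _ vs(2)] by simp
      then show False using Reg_K_unknot S(2) by simp
    next
      case False
      then obtain R where R: "R \<in> S" "unknotting_regions vs {R}"
        using single_unknotting_region[OF S(1) _ le3] by blast
      have "Reg_K K \<le> Reg_D vs" unfolding Reg_K_def using vs by (intro INF_lower) simp
      also have "\<dots> \<le> enat (creg vs R)"
        unfolding Reg_D_def using R(2) by (intro INF_lower) (simp add: unknotting_regions_def)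
      also have "\<dots> \<le> enat (\<Sum>R\<in>S. creg vs R)"
        using R(1) unknotting_regions_finite[OF S(1)] by (simp add: member_le_sum)
      finally show False using S(2) by (metis leD min_less_iff_conj)
    qed
  qed
  \<comment> \<open>Extended naturals are discrete, so exceeding 4 means being at least its
    successor; infinity is included.\<close>
  moreover from this assms(2) have "4 < Reg_K K" by (rule le_less_trans)
  then have "eSuc 4 \<le> Reg_K K" by (rule ileI1)
  then have "5 \<le> Reg_K K" by (simp add: eSuc_numeral)
  ultimately show ?thesis by blast
qed

end
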